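(* Let $N\ge1$ be an integer, $\mathcal{S}$ a Banach space and $\mathcal{H}$ a separable Hilbert space with inner product $\langle\cdot,\cdot\rangle$, norm $\|\cdot\|_{\mathcal{H}}$ and orthonormal basis $\{e_j:j\in\mathbb{N}\}$. Let $\{(X_s,Y_s):s\in\mathbb{N}^N\}$ be a stationary random field, where the $X_s$ are $\mathcal{S}$-valued and the $Y_s$ are $\mathcal{H}$-valued. Assume that there are positive constants $d_0,d_1,\kappa_0,\kappa_1,\gamma$ such that $$\mathbb{E}\left[\langle Y_s,e_j\rangle^2\right]\le d_0\exp(-d_1j)\ \text{ for all } j\in\mathbb{N}\quad\text{and}\quad\mathbb{P}(\|Y_s\|_{\mathcal{H}}\ge z)\le\kappa_0\exp(-\kappa_1z^\gamma)\ \text{ for all } z\ge 0.$$ Set $y_{j,s}:=\langle Y_s,e_j\rangle$ and $y_{j,s}^{(B)}:=\min(B,\max(-B,y_{j,s}))$ for $B>0$, and assume that $$\sup_{j\in\mathbb{N}}\ \sup_{B>0}\ \sum_{i\in\mathbb{N}}\phi_{\mathcal{C},y_{j,s}^{(B)}}(i)<\infty.$$ Let $\tilde g\in\mathcal{C}_1$ and set $S_n=\sum_{s\in I_n}Y_s\,\tilde g(X_s)\in\mathcal{H}$ for $n\in\mathbb{N}^N$. Then there are constants $A_1,A_2>0$, not depending on $n$ and $\epsilon$, such that for all $\epsilon>0$ $$\begin{aligned}\mathbb{P}\left(|I_n|^{-1}\|S_n-\mathbb{E}[S_n]\|_{\mathcal{H}}\ge\epsilon\right)\le\ &A_1\left[\epsilon^{-2}+m+m^{(4+5\gamma)/(4+2\gamma)}\epsilon^{-3\gamma/(2+\gamma)}\left(|I_n|^{1/N}(\|\tilde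 g\|^{\sim})^{-1}\right)^{(1-\gamma)/(2+\gamma)}\right]\\&\cdot\exp\left\{-A_2\left(\epsilon^2|I_n|^{1/N}(\|\tilde g\|^{\sim})^{-1}\right)^{\gamma/(2+2\gamma)}\right\},\end{aligned}$$ where $m=\left(\epsilon^2|I_n|^{1/N}(\|\tilde g\|^{\sim})^{-1}\right)^{\gamma/(2+2\gamma)}$. In particular, if $\gamma\ge1$, $$\begin{aligned}\mathbb{P}\left(|I_n|^{-1}\|S_n-\mathbb{E}[S_n]\|_{\mathcal{H}}\ge\epsilon\right)\le\ &A_1\left[\epsilon^{-2}+\left(\epsilon^2|I_n|^{1/N}(\|\tilde g\|^{\sim})^{-1}\right)^{1/4}+\left(\epsilon^2|I_n|^{1/N}(\|\tilde g\|^{\sim})^{-1}\right)^{9/24}\epsilon^{-1}\right]\\&\cdot\exp\left\{-A_2\left(\epsilon^2|I_n|^{1/N}(\|\tilde g\|^{\sim})^{-1}\right)^{1/4}\right\}.\end{aligned}$$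
   Context: All random variables live on a probability space $(\Omega,\mathcal{A},\mathbb{P})$; $\|U\|_{\mathbb{P},p}$ is the $L^p(\mathbb{P})$-norm of a real random variable $U$. For $n\in\mathbb{N}^N$, $I_n=\{s\in\mathbb{Z}^N:1\le s_i\le n_i,\ i=1,\dots,N\}$, with cardinality $|I_n|$. $\|\cdot\|_{\max}$ is the maximum norm. A random field is stationary if the joint distributions of its finite-dimensional marginals are invariant under translations of the index. Weak dependence coefficients: let $\mathcal{C}=\{g:\mathcal{S}\to\mathbb{R},\ \|g\|_\infty<\infty\}$ with $\|g\|_\infty=\sup_{x\in\mathcal{S}}|g(x)|$ (the $g$ need not be linear), let $\|\cdot\|^{\sim}$ be a pseudo-norm on $\mathcal{C}$ (meant to measure the roughness of $g$, for example its Lipschitz constant), and let $\mathcal{C}_1=\{g\in\mathcal{C}:\|g\|^{\sim}\le1\}$. For a stationary process $(X_s,y_s)$ with real-valued $y_s$ bounded by $b:=\|y_s\|_{\mathbb{P},\infty}<\infty$, let $\mathcal{M}_k=\sigma\{(X_s,y_s):1\le\|s\|_{\max}\le k\}$, $k\in\mathbb{N}$, and for $i\in\mathbb{N}$ $$\phi_{\mathcal{C},y_s}(i)=\sup\left\{\left\|\mathbb{E}\left[\tfrac{y_s}{b}g(X_s)\,\middle|\,\mathcal{M}_k\right]-\mathbb{E}\left[\tfrac{y_s}{b}g(X_s)\right]\right\|_{\mathbb{P},\infty}:\ g\in\mathcal{C}_1,\ k\in\mathbb{N},\ s\in\mathbb{N}^N,\ \|s\|_{\max}=k+i\right\}.$$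 The coefficient $\phi_{\mathcal{C},y_{j,s}^{(B)}}$ is obtained by applying this definition to the bounded process $y_s=y_{j,s}^{(B)}$. It is understood that $\|\tilde g\|^\sim>0$. *)

theory Defs
  imports "HOL-Probability.Probability"
begin

text \<open>
  Conventions: the natural numbers of the mathematical text start at 1. The dimension \<open>N\<close> is
  \<open>CARD('n)\<close>; lattice points are elements of \<open>nat ^ 'n\<close>, restricted to \<open>pos_index\<close>. Families
  indexed by \<open>nat\<close> (basis vectors, coefficients) are only ever used at indices \<open>\<ge> 1\<close>.
\<close>

definition pos_index :: "(nat ^ 'n::finite) set" where
  "pos_index = {s. \<forall>i. 1 \<le> s $ i}"

definition max_norm :: "nat ^ 'n::finite \<Rightarrow> nat" where
  "max_norm s = Max (range (\<lambda>i. s $ i))"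

definition rect :: "nat ^ 'n::finite \<Rightarrow> (nat ^ 'n) set" where
  "rect n = {s. \<forall>i. 1 \<le> s $ i \<and> s $ i \<le> n $ i}"

definition orthonormal_basis :: "(nat \<Rightarrow> 'h::real_inner) \<Rightarrow> bool" where
  "orthonormal_basis e \<longleftrightarrow>
     (\<forall>i\<ge>1. \<forall>j\<ge>1. inner (e i) (e j) = (if i = j then 1 else 0)) \<and>
     closure (span (e ` {1..})) = UNIV"

text \<open>
  Equality of the joint laws on every finite set of sites and on each of its translates. Shifts
  by vectors with nonnegative entries suffice: a pair of translates \<open>J\<close>, \<open>J + t\<close> inside
  \<open>pos_index\<close> with \<open>t\<close> an integer vector is covered by comparing each of them with the common
  translate of both by the positive respectively negative part of \<open>t\<close>.
\<close>

definition stationary_field ::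
  "'w measure \<Rightarrow> 'e measure \<Rightarrow> (nat ^ 'n::finite \<Rightarrow> 'w \<Rightarrow> 'e) \<Rightarrow> bool" where
  "stationary_field M E Z \<longleftrightarrow>
     (\<forall>s\<in>pos_index. Z s \<in> measurable M E) \<and>
     (\<forall>J t. finite J \<and> J \<subseteq> pos_index \<longrightarrow>
        distr M (PiM J (\<lambda>_. E)) (\<lambda>\<omega>. \<lambda>s\<in>J. Z (s + t) \<omega>) =
        distr M (PiM J (\<lambda>_. E)) (\<lambda>\<omega>. \<lambda>s\<in>J. Z s \<omega>))"

text \<open>
  The class \<open>\<C>\<close>. Measurability is part of the class, since \<open>g (X s)\<close> has to be a random
  variable.
\<close>

definition bounded_funs :: "('s::topological_space \<Rightarrow> real) set" where
  "bounded_funs = {g \<in> borel_measurable borel. bounded (range g)}"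

text \<open>
  A pseudo-norm on \<open>\<C>\<close> is a seminorm. The value \<open>\<infinity>\<close> is admitted, so that the Lipschitz
  constant of a bounded function is an example.
\<close>

definition pseudo_norm :: "(('s::topological_space \<Rightarrow> real) \<Rightarrow> ennreal) \<Rightarrow> bool" where
  "pseudo_norm p \<longleftrightarrow>
     p (\<lambda>x. 0) = 0 \<and>
     (\<forall>g\<in>bounded_funs. \<forall>c. p (\<lambda>x. c * g x) = ennreal \<bar>c\<bar> * p g) \<and>
     (\<forall>f\<in>bounded_funs. \<forall>g\<in>bounded_funs. p (\<lambda>x. f x + g x) \<le> p f + p g)"

definition unit_class ::
  "(('s::topological_space \<Rightarrow> real) \<Rightarrow> ennreal) \<Rightarrow> ('s \<Rightarrow> real) set" where
  "unit_class p = {g \<in> bounded_funs. p g \<le> 1}"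

definition Linf_norm :: "'w measure \<Rightarrow> ('w \<Rightarrow> real) \<Rightarrow> ennreal" where
  "Linf_norm M f = esssup M (\<lambda>\<omega>. ennreal \<bar>f \<omega>\<bar>)"

text \<open>The sigma-algebra \<open>\<M>\<^sub>k\<close>; only the sets (not the measure) of the result are relevant.\<close>

definition past_sigma ::
  "'w measure \<Rightarrow> (nat ^ 'n::finite \<Rightarrow> 'w \<Rightarrow> 's::topological_space) \<Rightarrow>
   (nat ^ 'n \<Rightarrow> 'w \<Rightarrow> real) \<Rightarrow> nat \<Rightarrow> 'w measure" where
  "past_sigma M X y k = sigma (space M)
     (\<Union>s\<in>{s \<in> pos_index. 1 \<le> max_norm s \<and> max_norm s \<le> k}.
        {(\<lambda>\<omega>. (X s \<omega>, y s \<omega>)) -` A \<inter> space M | A. A \<in> sets (borel \<Otimes>\<^sub>M borel)})"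

text \<open>
  The coefficient \<open>\<phi>\<close>. Under stationarity the bound \<open>b\<close> does not depend on \<open>s\<close>. If \<open>y s\<close>
  vanishes almost surely, then \<open>b = 0\<close> and \<open>y s / b\<close> is 0 by the convention for division.
\<close>

definition phi_coeff ::
  "'w measure \<Rightarrow> (('s::topological_space \<Rightarrow> real) \<Rightarrow> ennreal) \<Rightarrow>
   (nat ^ 'n::finite \<Rightarrow> 'w \<Rightarrow> 's) \<Rightarrow> (nat ^ 'n \<Rightarrow> 'w \<Rightarrow> real) \<Rightarrow> nat \<Rightarrow> ennreal" where
  "phi_coeff M p X y i =
     (SUP (g, k, s) \<in> {(g, k, s). g \<in> unit_class p \<and> 1 \<le> k \<and> s \<in> pos_index \<and>
                                  max_norm s = k + i}.
        let b = enn2real (Linf_norm M (y s));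
            U = (\<lambda>\<omega>. y s \<omega> / b * g (X s \<omega>))
        in Linf_norm M (\<lambda>\<omega>. real_cond_exp M (past_sigma M X y k) U \<omega> - integral\<^sup>L M U))"

definition truncated_coord ::
  "(nat \<Rightarrow> 'h::real_inner) \<Rightarrow> ('i \<Rightarrow> 'w \<Rightarrow> 'h) \<Rightarrow> nat \<Rightarrow> real \<Rightarrow> 'i \<Rightarrow> 'w \<Rightarrow> real" where
  "truncated_coord e Y j B s \<omega> = min B (max (- B) (inner (Y s \<omega>) (e j)))"

definition field_sum ::
  "(nat ^ 'n::finite \<Rightarrow> 'w \<Rightarrow> 's) \<Rightarrow> (nat ^ 'n \<Rightarrow> 'w \<Rightarrow> 'h::real_vector) \<Rightarrow> ('s \<Rightarrow> real) \<Rightarrow>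
   nat ^ 'n \<Rightarrow> 'w \<Rightarrow> 'h" where
  "field_sum X Y g n \<omega> = (\<Sum>s\<in>rect n. g (X s \<omega>) *\<^sub>R Y s \<omega>)"

end

theory Submission
  imports Defs
begin

text \<open>
  Let \<open>K\<close> be the largest entry of \<open>n\<close>. For the sum of a bounded coordinate field, the
  conditional expectations along \<open>\<M>\<^sub>0 \<subseteq> \<M>\<^sub>1 \<subseteq> \<dots> \<subseteq> \<M>\<^sub>K\<close> form a martingale whose increments are at most
  a constant times \<open>B\<close> times the largest shell \<open>{s \<in> rect n. max_norm s = k}\<close>, because the
  mixing coefficients are summable. A shell contains at most \<open>N |I\<^sub>n| / K\<close> sites, whatever the
  shape of the rectangle, so an Azuma inequality gives a tail \<open>2 exp (- c t\<^sup>2 K / B\<^sup>2)\<close>, where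
  \<open>K \<ge> |I\<^sub>n|\<close> to the power \<open>1 / N\<close>.

  In the Hilbert space, project onto the first \<open>J\<close> coordinates and truncate them at \<open>B\<close>; what
  remains has norm at most \<open>\<parallel>Y - proj J Y\<parallel> + \<parallel>Y\<parallel> 1{\<parallel>Y\<parallel> \<ge> B}\<close>, whose mean is exponentially small
  by the moment and the tail condition, and is handled by Markov's inequality. The choice
  \<open>J = \<lceil>m\<rceil>\<close> and \<open>B\<^sup>\<gamma> = m\<close> makes all exponents proportional to \<open>m\<close>, and the resulting bound
  already holds without the third summand in the bracket. For \<open>\<gamma> \<ge> 1\<close>, the tail condition also
  holds with exponent 1 in place of \<open>\<gamma>\<close>, which gives the second inequality.
\<close>

section \<open>Azuma inequality for Doob martingales\<close>

text \<open>The linear term has mean zero when \<open>x\<close> is a multiple of a martingale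
  increment, so that only the sub-Gaussian factor \<open>exp (x\<^sup>2)\<close> survives
  integration.\<close>

lemma exp_le_add_exp_square: "exp x \<le> x + exp (x\<^sup>2)" for x :: real
proof -
  have sq: "1 + x\<^sup>2 \<le> exp (x\<^sup>2)" by (rule exp_ge_add_one_self)
  consider "x \<ge> 1" | "0 \<le> x" "x \<le> 1" | "x < 0" by linarith
  then show ?thesis
  proof cases
    case 1
    then have "x \<le> x\<^sup>2" by (simp add: power2_eq_square)
    then have "exp x \<le> exp (x\<^sup>2)" by simp
    then show ?thesis using 1 by linarith
  next
    case 2
    then have "exp x \<le> 1 + x + x\<^sup>2" by (rule exp_bound)
    then show ?thesis using sq by linarith
  next
    case 3
    \<comment> \<open>For negative \<open>x\<close>, \<open>exp x\<close> is at most
      \<open>1 / (1 - x)\<close>, which lies below \<open>1 + x + x\<^sup>2\<close> because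
      \<open>1 - x ^ 3\<close> is at least 1.\<close>
    have "1 - x \<le> exp (- x)" using exp_ge_add_one_self[of "- x"] by simp
    then have "exp x * (1 - x) \<le> 1"
      using mult_left_mono[of "1 - x" "exp (- x)" "exp x"] by (simp add: exp_minus)
    moreover have "1 \<le> (1 + x + x\<^sup>2) * (1 - x)"
    proof -
      have "(1 + x + x\<^sup>2) * (1 - x) = 1 - x * x\<^sup>2" by (simp add: algebra_simps power2_eq_square)
      moreover have "x * x\<^sup>2 \<le> 0" using 3 by (simp add: mult_nonpos_nonneg)
      ultimately show ?thesis by linarith
    qed
    ultimately have "exp x * (1 - x) \<le> (1 + x + x\<^sup>2) * (1 - x)" by linarith
    then have "exp x \<le> 1 + x + x\<^sup>2" using 3 by simp
    then show ?thesis using sq by linarith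
  qed
qed

text \<open>Induction on \<open>r\<close>: the bound \<open>exp D \<le> D + exp (D\<^sup>2)\<close>
  for the scaled increment is weighted with \<open>exp (l * Z r x)\<close>. The linear part
  integrates to zero, and every step costs a factor
  \<open>exp (l\<^sup>2 * c\<^sup>2)\<close>.\<close>

lemma (in prob_space) cond_exp_mgf_bound:
  fixes F :: "nat \<Rightarrow> 'a measure" and S :: "'a \<Rightarrow> real"
  assumes sub: "\<And>r. subalgebra M (F r)"
    and mono: "\<And>r. subalgebra (F (Suc r)) (F r)"
    and S: "integrable M S"
    and start: "AE x in M. real_cond_exp M (F 0) S x = expectation S"
    and diff: "\<And>r. AE x in M. \<bar>real_cond_exp M (F (Suc r)) S x - real_cond_exp M (F r) S x\<bar> \<le> c"
  defines "Z \<equiv> \<lambda>r x. real_cond_exp M (F r) S x - expectation S"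
  shows "integrable M (\<lambda>x. exp (l * Z r x)) \<and>
         expectation (\<lambda>x. exp (l * Z r x)) \<le> exp (real r * (l\<^sup>2 * c\<^sup>2))"
proof -
  have sfs: "sigma_finite_subalgebra M (F r)" for r
    by (intro finite_measure_subalgebra_is_sigma_finite finite_measure_subalgebra.intro
        finite_measure_subalgebra_axioms.intro finite_measure_axioms sub)
  have ZF: "Z r \<in> borel_measurable (F r)" for r
    unfolding Z_def by measurable
  have ZM[measurable]: "Z r \<in> borel_measurable M" for r
    by (rule measurable_from_subalg[OF sub ZF])
  \<comment> \<open>The martingale is bounded almost everywhere after \<open>r\<close> steps, which
    makes the exponentials and their products with \<open>S\<close> integrable.\<close>
  have bnd: "AE x in M. \<bar>Z r x\<bar> \<le> real r * c" for r
  proof (induction r)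
    case 0
    from start show ?case unfolding Z_def by eventually_elim simp
  next
    case (Suc r)
    from Suc diff[of r] show ?case
      unfolding Z_def by eventually_elim (simp add: algebra_simps abs_if split: if_splits)
  qed
  have int_exp: "integrable M (\<lambda>x. exp (l * Z r x))" for r
  proof (rule integrable_const_bound[where B = "exp (\<bar>l\<bar> * (real r * c))"])
    from bnd[of r] show "AE x in M. norm (exp (l * Z r x)) \<le> exp (\<bar>l\<bar> * (real r * c))"
    proof eventually_elim
      case (elim x)
      have "l * Z r x \<le> \<bar>l\<bar> * \<bar>Z r x\<bar>" by (metis abs_ge_self abs_mult)
      also have "\<dots> \<le> \<bar>l\<bar> * (real r * c)" by (intro mult_left_mono elim) auto
      finally show ?case by simp
    qed
  qed measurable
  have "expectation (\<lambda>x. exp (l * Z r x)) \<le> exp (real r * (l\<^sup>2 * c\<^sup>2))"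
  proof (induction r)
    case 0
    have "expectation (\<lambda>x. exp (l * Z 0 x)) = expectation (\<lambda>x. 1)"
      using start by (intro integral_cong_AE) (auto simp: Z_def elim!: eventually_mono)
    then show ?case by (simp add: prob_space)
  next
    case (Suc r)
    define h where "h = (\<lambda>x. exp (l * Z r x))"
    have hF: "h \<in> borel_measurable (F r)"
      unfolding h_def using ZF[of r] by measurable
    have hF': "h \<in> borel_measurable (F (Suc r))"
      by (rule measurable_from_subalg[OF mono hF])
    have hM[measurable]: "h \<in> borel_measurable M"
      by (rule measurable_from_subalg[OF sub hF])
    have hint: "integrable M h" unfolding h_def by (rule int_exp)
    have hS: "integrable M (\<lambda>x. h x * S x)"
    proof (rule Bochner_Integration.integrable_bound)
      show "integrable M (\<lambda>x. exp (\<bar>l\<bar> * (real r * c)) * S x)" using S by simp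
      show "(\<lambda>x. h x * S x) \<in> borel_measurable M" using S by measurable
      from bnd[of r] show "AE x in M. norm (h x * S x) \<le> norm (exp (\<bar>l\<bar> * (real r * c)) * S x)"
      proof eventually_elim
        case (elim x)
        have "l * Z r x \<le> \<bar>l\<bar> * \<bar>Z r x\<bar>" by (metis abs_ge_self abs_mult)
        also have "\<dots> \<le> \<bar>l\<bar> * (real r * c)" by (intro mult_left_mono elim) auto
        finally show ?case by (simp add: h_def abs_mult mult_right_mono)
      qed
    qed
    have SM: "S \<in> borel_measurable M" using S by simp
    \<comment> \<open>The weight \<open>h\<close> is measurable for \<open>F r\<close> and hence for
      \<open>F (Suc r)\<close>. Integrated against \<open>h\<close>, both conditional expectations
      may therefore be replaced by \<open>S\<close>, and their difference has mean zero.\<close>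
    note A = sigma_finite_subalgebra.real_cond_exp_intg[OF sfs hS hF SM]
    note B = sigma_finite_subalgebra.real_cond_exp_intg[OF sfs hS hF' SM]
    have eq: "h x * (Z (Suc r) x - Z r x)
        = h x * real_cond_exp M (F (Suc r)) S x - h x * real_cond_exp M (F r) S x" for x
      by (simp add: Z_def algebra_simps)
    have Dint: "integrable M (\<lambda>x. h x * (Z (Suc r) x - Z r x))"
      unfolding eq using A(1) B(1) by (rule Bochner_Integration.integrable_diff[rotated])
    have Dzero: "expectation (\<lambda>x. h x * (Z (Suc r) x - Z r x)) = 0"
      unfolding eq using A B by simp
    have "expectation (\<lambda>x. exp (l * Z (Suc r) x))
        \<le> expectation (\<lambda>x. l * (h x * (Z (Suc r) x - Z r x)) + exp (l\<^sup>2 * c\<^sup>2) * h x)"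
    proof (rule integral_mono_AE)
      show "integrable M (\<lambda>x. exp (l * Z (Suc r) x))" by (rule int_exp)
      show "integrable M (\<lambda>x. l * (h x * (Z (Suc r) x - Z r x)) + exp (l\<^sup>2 * c\<^sup>2) * h x)"
        using Dint hint by simp
      from diff[of r] show "AE x in M. exp (l * Z (Suc r) x)
          \<le> l * (h x * (Z (Suc r) x - Z r x)) + exp (l\<^sup>2 * c\<^sup>2) * h x"
      proof eventually_elim
        case (elim x)
        define D where "D = Z (Suc r) x - Z r x"
        have "\<bar>D\<bar> \<le> c" using elim by (simp add: D_def Z_def)
        then have "D\<^sup>2 \<le> c\<^sup>2" by (metis abs_ge_zero power2_abs power_mono)
        then have "l\<^sup>2 * D\<^sup>2 \<le> l\<^sup>2 * c\<^sup>2" by (simp add: mult_left_mono)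
        then have "exp (l * D) \<le> l * D + exp (l\<^sup>2 * c\<^sup>2)"
          using exp_le_add_exp_square[of "l * D"]
          by (smt (verit) exp_le_cancel_iff power_mult_distrib)
        then have "h x * exp (l * D) \<le> h x * (l * D + exp (l\<^sup>2 * c\<^sup>2))"
          by (intro mult_left_mono) (auto simp: h_def)
        moreover have "h x * exp (l * D) = exp (l * Z (Suc r) x)"
          by (simp add: h_def D_def exp_add[symmetric] algebra_simps)
        ultimately show ?case by (simp add: D_def algebra_simps)
      qed
    qed
    also have "\<dots> = exp (l\<^sup>2 * c\<^sup>2) * expectation h"
      using Dint hint Dzero by simp
    also have "\<dots> \<le> exp (l\<^sup>2 * c\<^sup>2) * exp (real r * (l\<^sup>2 * c\<^sup>2))"
      using Suc.IH by (intro mult_left_mono) (auto simp: h_def)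
    also have "\<dots> = exp (real (Suc r) * (l\<^sup>2 * c\<^sup>2))"
      by (simp add: exp_add[symmetric] algebra_simps)
    finally show ?case .
  qed
  with int_exp show ?thesis by simp
qed

text \<open>Chernoff's method for the Doob martingale of \<open>S\<close>, which starts at the mean
  and has reached \<open>S\<close> itself at time \<open>K\<close>.\<close>

lemma (in prob_space) azuma_doob:
  fixes F :: "nat \<Rightarrow> 'a measure" and S :: "'a \<Rightarrow> real"
  assumes sub: "\<And>r. subalgebra M (F r)"
    and mono: "\<And>r. subalgebra (F (Suc r)) (F r)"
    and S: "integrable M S"
    and start: "AE x in M. real_cond_exp M (F 0) S x = expectation S"
    and diff: "\<And>r. AE x in M. \<bar>real_cond_exp M (F (Suc r)) S x - real_cond_exp M (F r) S x\<bar> \<le> c"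
    and final: "AE x in M. real_cond_exp M (F K) S x = S x"
    and "K > 0" "c > 0" "t > 0"
  shows "prob {x\<in>space M. \<bar>S x - expectation S\<bar> \<ge> t} \<le> 2 * exp (- (t\<^sup>2 / (4 * real K * c\<^sup>2)))"
proof -
  have [measurable]: "S \<in> borel_measurable M" using S by simp
  \<comment> \<open>This value minimises
    \<open>real K * (l\<^sup>2 * c\<^sup>2) - l * t\<close>.\<close>
  define l where "l = t / (2 * real K * c\<^sup>2)"
  have l: "l > 0" using assms by (simp add: l_def)
  \<comment> \<open>The sign \<open>u\<close> treats the upper and the lower tail together; the
    moment bound depends on \<open>l * u\<close> only through its square.\<close>
  have one_side: "prob {x\<in>space M. u * (S x - expectation S) \<ge> t} \<le> exp (- (t\<^sup>2 / (4 * real K * c\<^sup>2)))"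
    if u: "\<bar>u\<bar> = 1" for u :: real
  proof -
    let ?e = "\<lambda>x. exp (l * (u * (S x - expectation S)))"
    have AEeq: "AE x in M. exp ((l * u) * (real_cond_exp M (F K) S x - expectation S)) = ?e x"
      using final by eventually_elim (simp add: mult_ac)
    have [measurable]: "real_cond_exp M (F K) S \<in> borel_measurable M" by measurable
    note mgf = cond_exp_mgf_bound[OF sub mono S start diff, of "l * u" K]
    have int: "integrable M ?e"
      using mgf integrable_cong_AE[OF _ _ AEeq] by simp
    have E: "expectation ?e \<le> exp (real K * (l\<^sup>2 * c\<^sup>2))"
    proof -
      have "(l * u)\<^sup>2 = l\<^sup>2" using u by (metis mult.right_neutral one_power2 power2_abs power_mult_distrib)
      then show ?thesis using mgf integral_cong_AE[OF _ _ AEeq] by simp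
    qed
    have "prob {x\<in>space M. u * (S x - expectation S) \<ge> t} = prob {x\<in>space M. ?e x \<ge> exp (l * t)}"
      using l by simp
    also have "\<dots> \<le> expectation ?e / exp (l * t)"
      by (rule integral_Markov_inequality_measure[where A = "{}"]) (use int in auto)
    also have "\<dots> \<le> exp (real K * (l\<^sup>2 * c\<^sup>2)) / exp (l * t)"
      using E by (simp add: divide_right_mono)
    also have "\<dots> = exp (real K * (l\<^sup>2 * c\<^sup>2) - l * t)" by (simp add: exp_diff)
    also have "real K * (l\<^sup>2 * c\<^sup>2) - l * t = - (t\<^sup>2 / (4 * real K * c\<^sup>2))"
      using assms unfolding l_def by (simp add: field_simps power2_eq_square)
    finally show ?thesis .
  qed
  have "{x\<in>space M. \<bar>S x - expectation S\<bar> \<ge> t}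
      = {x\<in>space M. 1 * (S x - expectation S) \<ge> t} \<union> {x\<in>space M. (- 1) * (S x - expectation S) \<ge> t}"
    by auto
  then have "prob {x\<in>space M. \<bar>S x - expectation S\<bar> \<ge> t}
      \<le> prob {x\<in>space M. 1 * (S x - expectation S) \<ge> t} + prob {x\<in>space M. (- 1) * (S x - expectation S) \<ge> t}"
    by (simp only:) (intro measure_Un_le; measurable)
  then show ?thesis using one_side[of 1] one_side[of "- 1"] by simp
qed

section \<open>Shells of a rectangle\<close>

lemma finite_rect: "finite (rect n)"
  and card_rect: "card (rect n) = (\<Prod>i\<in>UNIV. n $ i)"
proof -
  have "bij_betw vec_nth (rect n) (PiE UNIV (\<lambda>i. {1..n $ i}))"
    by (rule bij_betw_byWitness[where f' = vec_lambda]) (auto simp: rect_def PiE_def)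
  moreover have "card (PiE UNIV (\<lambda>i. {1..n $ i})) = (\<Prod>i\<in>UNIV. n $ i)"
    by (simp add: card_PiE)
  moreover have "finite (PiE UNIV (\<lambda>i. {1..n $ i}))"
    by (intro finite_PiE) auto
  ultimately show "finite (rect n)" "card (rect n) = (\<Prod>i\<in>UNIV. n $ i)"
    using bij_betw_finite bij_betw_same_card by metis+
qed

lemma le_max_norm: "s $ i \<le> max_norm s"
  unfolding max_norm_def by (intro Max_ge) auto

lemma max_norm_attained: "\<exists>i. s $ i = max_norm s"
  using Max_in[of "range (\<lambda>i. s $ i)"] unfolding max_norm_def by fastforce

lemma max_norm_ge_1: "s \<in> pos_index \<Longrightarrow> 1 \<le> max_norm s"
  using le_max_norm[of s undefined] by (force simp: pos_index_def intro: order_trans)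

lemma rect_subset_pos_index: "rect n \<subseteq> pos_index"
  by (auto simp: rect_def pos_index_def)

lemma max_norm_rect_le: "s \<in> rect n \<Longrightarrow> max_norm s \<le> max_norm n"
  by (metis (mono_tags, lifting) le_max_norm max_norm_attained mem_Collect_eq order_trans rect_def)

lemma card_rect_pos: "n \<in> pos_index \<Longrightarrow> 1 \<le> card (rect n)"
  unfolding card_rect by (rule prod_ge_1) (simp add: pos_index_def)

lemma card_rect_le_power: "card (rect (n :: nat ^ 'n::finite)) \<le> max_norm n ^ CARD('n)"
  unfolding card_rect using prod_mono[of UNIV "\<lambda>i. n $ i" "\<lambda>_. max_norm n"]
  by (simp add: le_max_norm)

text \<open>The shell is covered by the faces \<open>A j\<close> on which entry \<open>j\<close>
  equals \<open>k\<close>. Freezing entry \<open>j\<close> alone would only save a factor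
  \<open>n $ j\<close>, which is too little for a short side; the injection saves the length of the
  longest side for every \<open>j\<close>.\<close>

lemma card_shell:
  fixes n :: "nat ^ 'n::finite"
  shows "card {s \<in> rect n. max_norm s = k} * max_norm n \<le> CARD('n) * card (rect n)"
proof -
  obtain l where l: "n $ l = max_norm n" using max_norm_attained by blast
  define A where "A j = {s \<in> rect n. max_norm s = k \<and> s $ j = k}" for j
  have A: "card (A j) * max_norm n \<le> card (rect n)" for j
  proof -
    \<comment> \<open>Site \<open>s\<close> has \<open>s j = k\<close> redundant; move the entry at the longest side \<open>l\<close> to
      position \<open>j\<close>, where it fits because \<open>s l \<le> k \<le> n j\<close>, and make entry \<open>l\<close> free.\<close>
    let ?f = "\<lambda>(s, t). \<chi> i. if i = l then t else if i = j then s $ l else s $ i"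
    have "inj_on ?f (A j \<times> {1..max_norm n})"
    proof (rule inj_onI, clarify)
      fix s t s' t'
      assume s: "s \<in> A j" "s' \<in> A j"
        and eq: "(\<chi> i. if i = l then t else if i = j then s $ l else s $ i)
          = (\<chi> i. if i = l then t' else if i = j then s' $ l else s' $ i)"
      have eqi: "(if i = l then t else if i = j then s $ l else s $ i)
          = (if i = l then t' else if i = j then s' $ l else s' $ i)" for i
        using arg_cong[OF eq, of "\<lambda>v. v $ i"] by simp
      \<comment> \<open>For \<open>j \<noteq> l\<close> the old entry at \<open>l\<close> is read
        off at position \<open>j\<close>. Entry \<open>j\<close> is \<open>k\<close> in both sites,
        which also settles the case \<open>j = l\<close>.\<close>
      have "s $ i = s' $ i" for i
        using eqi[of i] eqi[of j] eqi[of l] s by (cases "i = l"; cases "i = j") (auto simp: A_def)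
      then show "s = s' \<and> t = t'" using eqi[of l] by (auto simp: vec_eq_iff)
    qed
    moreover have "?f ` (A j \<times> {1..max_norm n}) \<subseteq> rect n"
    proof clarify
      fix s t assume s: "s \<in> A j" and t: "t \<in> {1..max_norm n}"
      have "s $ l \<le> s $ j" using s le_max_norm[of s l] by (simp add: A_def)
      also have "s $ j \<le> n $ j" using s unfolding A_def rect_def by blast
      finally have "s $ l \<le> n $ j" .
      then show "(\<chi> i. if i = l then t else if i = j then s $ l else s $ i) \<in> rect n"
        using s t l by (auto simp: A_def rect_def)
    qed
    ultimately have "card (A j \<times> {1..max_norm n}) \<le> card (rect n)"
      using finite_rect card_inj_on_le by blast
    then show ?thesis by (simp add: card_cartesian_product)
  qed
  have "{s \<in> rect n. max_norm s = k} = (\<Union>j. A j)"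
    using max_norm_attained by (fastforce simp: A_def)
  then have "card {s \<in> rect n. max_norm s = k} \<le> (\<Sum>j\<in>UNIV. card (A j))"
    by (simp add: card_UN_le)
  then have "card {s \<in> rect n. max_norm s = k} * max_norm n \<le> (\<Sum>j\<in>UNIV. card (A j) * max_norm n)"
    by (simp add: sum_distrib_right[symmetric])
  also have "\<dots> \<le> (\<Sum>j\<in>(UNIV :: 'n set). card (rect n))" by (intro sum_mono A)
  finally show ?thesis by simp
qed

text \<open>Grouping the sites by shells reduces the sum of a radial function to a sum over the
  radius, each shell being counted with the uniform bound of \<open>card_shell\<close>.\<close>

lemma sum_rect_max_norm_le:
  fixes n :: "nat ^ 'n::finite" and f :: "nat \<Rightarrow> real"
  assumes n: "n \<in> pos_index" and f: "\<And>k. f k \<ge> 0"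
  shows "(\<Sum>s\<in>rect n. f (max_norm s))
    \<le> real CARD('n) * real (card (rect n)) / real (max_norm n) * (\<Sum>k\<in>{1..max_norm n}. f k)"
proof -
  have K: "max_norm n \<ge> 1" by (rule max_norm_ge_1[OF n])
  have "max_norm ` rect n \<subseteq> {1..max_norm n}"
    using max_norm_rect_le max_norm_ge_1 rect_subset_pos_index by fastforce
  then have "(\<Sum>s\<in>rect n. f (max_norm s))
      = (\<Sum>k\<in>{1..max_norm n}. \<Sum>s\<in>{s \<in> rect n. max_norm s = k}. f (max_norm s))"
    by (intro sum.group[symmetric] finite_rect) auto
  also have "\<dots> = (\<Sum>k\<in>{1..max_norm n}. real (card {s \<in> rect n. max_norm s = k}) * f k)"
    by (intro sum.cong) auto
  also have "\<dots> \<le> (\<Sum>k\<in>{1..max_norm n}. real CARD('n) * real (card (rect n)) / real (max_norm n) * f k)"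
  proof (intro sum_mono mult_right_mono f)
    fix k
    have "real (card {s \<in> rect n. max_norm s = k} * max_norm n) \<le> real (CARD('n) * card (rect n))"
      using card_shell[of n k] by (simp only: of_nat_le_iff)
    then show "real (card {s \<in> rect n. max_norm s = k})
        \<le> real CARD('n) * real (card (rect n)) / real (max_norm n)"
      using K by (simp add: le_divide_eq)
  qed
  finally show ?thesis by (simp add: sum_distrib_left)
qed

section \<open>Bounded mixing fields\<close>

text \<open>This is the input of the martingale argument. In the application \<open>y\<close> is one
  truncated coordinate of the Hilbert space field, so its bound \<open>B\<close> holds everywhere.
  The coefficients are summed from lag 1 on, hence the \<open>Suc\<close>.\<close>

locale bounded_mixing_field = prob_space M for M :: "'w measure" +
  fixes X :: "nat ^ 'n::finite \<Rightarrow> 'w \<Rightarrow> 's::topological_space"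
    and y :: "nat ^ 'n \<Rightarrow> 'w \<Rightarrow> real"
    and p :: "('s \<Rightarrow> real) \<Rightarrow> ennreal"
    and h :: "'s \<Rightarrow> real"
    and B G \<Phi> :: real
  assumes X_measurable: "s \<in> pos_index \<Longrightarrow> X s \<in> borel_measurable M"
    and y_measurable: "s \<in> pos_index \<Longrightarrow> y s \<in> borel_measurable M"
    and y_bound: "\<bar>y s \<omega>\<bar> \<le> B"
    and h: "h \<in> unit_class p"
    and h_bound: "\<bar>h x\<bar> \<le> G"
    and phi_sum: "(\<Sum>i. phi_coeff M p X y (Suc i)) \<le> ennreal \<Phi>"
    and B_pos: "B > 0" and G_pos: "G > 0" and Phi_nonneg: "\<Phi> \<ge> 0"
begin

section \<open>Summands of the field and summable mixing rates\<close>

abbreviation past :: "nat \<Rightarrow> 'w measure" where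
  "past \<equiv> past_sigma M X y"

abbreviation term_at :: "nat ^ 'n \<Rightarrow> 'w \<Rightarrow> real" where
  "term_at s \<equiv> \<lambda>\<omega>. y s \<omega> * h (X s \<omega>)"

text \<open>\<open>B * \<psi> i\<close> bounds the deviation of a conditional expectation from the
  mean at lag \<open>i\<close>. At lag 0 the summand is known, and the trivial bound
  \<open>2 * G\<close> takes the place of a coefficient. At positive lags
  \<open>phi_less_top\<close> ensures that \<open>enn2real\<close> loses nothing.\<close>

definition \<psi> :: "nat \<Rightarrow> real" where
  "\<psi> i = (if i = 0 then 2 * G else enn2real (phi_coeff M p X y i))"

lemma h_measurable [measurable]: "h \<in> borel_measurable borel"
  using h by (simp add: unit_class_def bounded_funs_def)

lemma phi_less_top: "phi_coeff M p X y (Suc i) < \<top>"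
proof -
  have "phi_coeff M p X y (Suc i) \<le> (\<Sum>i. phi_coeff M p X y (Suc i))"
    using sum_le_suminf[of "\<lambda>i. phi_coeff M p X y (Suc i)" "{i}"] by simp
  also have "\<dots> < \<top>" using phi_sum by (simp add: le_less_trans)
  finally show ?thesis .
qed

lemma psi_nonneg: "\<psi> i \<ge> 0"
  using G_pos by (simp add: \<psi>_def)

lemma sum_psi_le: "(\<Sum>i\<le>m. \<psi> i) \<le> 2 * G + \<Phi>"
proof -
  have "ennreal (\<Sum>i<m. enn2real (phi_coeff M p X y (Suc i))) = (\<Sum>i<m. phi_coeff M p X y (Suc i))"
    by (simp add: sum_ennreal[symmetric] phi_less_top)
  also have "\<dots> \<le> (\<Sum>i. phi_coeff M p X y (Suc i))" by (intro sum_le_suminf) auto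
  also have "\<dots> \<le> ennreal \<Phi>" by (rule phi_sum)
  finally have "(\<Sum>i<m. enn2real (phi_coeff M p X y (Suc i))) \<le> \<Phi>"
    using Phi_nonneg by simp
  then show ?thesis unfolding sum.atMost_shift by (simp add: \<psi>_def)
qed

lemma pair_measurable: "s \<in> pos_index \<Longrightarrow> (\<lambda>\<omega>. (X s \<omega>, y s \<omega>)) \<in> measurable M (borel \<Otimes>\<^sub>M borel)"
  using X_measurable y_measurable by measurable

lemma term_at_measurable: "s \<in> pos_index \<Longrightarrow> term_at s \<in> borel_measurable M"
  using X_measurable y_measurable by measurable

lemma term_at_bound: "\<bar>term_at s \<omega>\<bar> \<le> B * G"
  using y_bound[of s \<omega>] h_bound[of "X s \<omega>"] B_pos by (simp add: abs_mult mult_mono)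

lemma term_at_integrable: "s \<in> pos_index \<Longrightarrow> integrable M (term_at s)"
  using term_at_bound by (intro integrable_const_bound[where B = "B * G"] term_at_measurable) auto

section \<open>The filtration of the pasts\<close>

lemma past_generators:
  "(\<Union>s\<in>{s \<in> pos_index. 1 \<le> max_norm s \<and> max_norm s \<le> k}.
     {(\<lambda>\<omega>. (X s \<omega>, y s \<omega>)) -` A \<inter> space M | A. A \<in> sets (borel \<Otimes>\<^sub>M borel)}) \<subseteq> sets M"
  using pair_measurable by (auto intro: measurable_sets)

lemma space_past [simp]: "space (past k) = space M"
  unfolding past_sigma_def by (rule space_measure_of_conv)

lemma sets_past: "sets (past k) = sigma_sets (space M)
  (\<Union>s\<in>{s \<in> pos_index. 1 \<le> max_norm s \<and> max_norm s \<le> k}.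
     {(\<lambda>\<omega>. (X s \<omega>, y s \<omega>)) -` A \<inter> space M | A. A \<in> sets (borel \<Otimes>\<^sub>M borel)})"
  unfolding past_sigma_def by (rule sets_measure_of) auto

lemma subalgebra_past: "subalgebra M (past k)"
  unfolding subalgebra_def sets_past
  using sets.sigma_sets_subset[OF past_generators] by simp

lemma past_mono: "subalgebra (past (Suc k)) (past k)"
  unfolding subalgebra_def sets_past space_past
  by (intro conjI refl sigma_sets_mono' UN_mono) auto

lemma sets_past_0: "sets (past 0) = {{}, space M}"
proof -
  have "{s \<in> pos_index :: (nat ^ 'n) set. 1 \<le> max_norm s \<and> max_norm s \<le> 0} = {}" by auto
  then show ?thesis unfolding sets_past by (simp only: UN_empty sigma_sets_empty_eq)
qed

lemma sigma_finite_past: "sigma_finite_subalgebra M (past k)"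
  by (intro finite_measure_subalgebra_is_sigma_finite finite_measure_subalgebra.intro
      finite_measure_subalgebra_axioms.intro finite_measure_axioms subalgebra_past)

lemma term_at_past_measurable:
  assumes "s \<in> pos_index" "max_norm s \<le> k"
  shows "term_at s \<in> borel_measurable (past k)"
proof -
  have "(\<lambda>\<omega>. (X s \<omega>, y s \<omega>)) \<in> measurable (past k) (borel \<Otimes>\<^sub>M borel)"
  proof (rule measurableI)
    fix A :: "('s \<times> real) set" assume "A \<in> sets (borel \<Otimes>\<^sub>M borel)"
    then show "(\<lambda>\<omega>. (X s \<omega>, y s \<omega>)) -` A \<inter> space (past k) \<in> sets (past k)"
      unfolding sets_past space_past
      using assms max_norm_ge_1[of s] by (intro sigma_sets.Basic) blast
  qed (simp add: space_pair_measure)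
  moreover have "(\<lambda>(x, u). u * h x) \<in> borel_measurable (borel \<Otimes>\<^sub>M borel)" by measurable
  ultimately have "(\<lambda>(x, u). u * h x) \<circ> (\<lambda>\<omega>. (X s \<omega>, y s \<omega>)) \<in> borel_measurable (past k)"
    by (rule measurable_comp)
  then show ?thesis by (simp add: comp_def)
qed

text \<open>The mixing coefficients only speak of \<open>k \<ge> 1\<close>, so the starting time of
  the martingale is treated apart. Sites have maximum norm at least 1, hence \<open>past 0\<close>
  is trivial and conditioning on it gives the mean.\<close>

lemma cond_exp_past_0:
  assumes "integrable M f"
  shows "AE \<omega> in M. real_cond_exp M (past 0) f \<omega> = expectation f"
proof (rule sigma_finite_subalgebra.real_cond_exp_charact[OF sigma_finite_past])
  fix A assume "A \<in> sets (past 0)"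
  then consider "A = {}" | "A = space M" by (auto simp: sets_past_0)
  then show "(LINT x:A|M. f x) = (LINT x:A|M. expectation f)"
  proof cases
    case 1
    then show ?thesis by (simp add: set_lebesgue_integral_def)
  next
    case 2
    then show ?thesis by (simp add: set_integral_space assms prob_space)
  qed
qed (use assms in auto)

section \<open>Conditional expectations of a single summand\<close>

lemma cond_exp_phi:
  assumes s: "s \<in> pos_index" and k: "1 \<le> k" and i: "max_norm s = k + Suc i"
  shows "AE \<omega> in M. \<bar>real_cond_exp M (past k) (term_at s) \<omega> - expectation (term_at s)\<bar> \<le> B * \<psi> (Suc i)"
proof -
  interpret P: sigma_finite_subalgebra M "past k" by (rule sigma_finite_past)
  note [measurable] = X_measurable[OF s] y_measurable[OF s]
  \<comment> \<open>The coefficient normalises \<open>y s\<close> by its essential supremum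
    \<open>b\<close>, which may be smaller than \<open>B\<close> and even 0. The estimate is made
    for the normalised \<open>U\<close> and then rescaled by \<open>b \<le> B\<close>.\<close>
  define b where "b = enn2real (Linf_norm M (y s))"
  define U where "U = (\<lambda>\<omega>. y s \<omega> / b * h (X s \<omega>))"
  have U[measurable]: "U \<in> borel_measurable M" unfolding U_def by measurable
  have L: "Linf_norm M (y s) \<le> ennreal B"
    unfolding Linf_norm_def using y_bound by (intro esssup_I) (auto intro: ennreal_leI)
  then have Lfin: "Linf_norm M (y s) < \<top>" by (simp add: le_less_trans)
  have b: "0 \<le> b" "b \<le> B"
    using L B_pos by (auto simp: b_def enn2real_leI)
  have yb: "AE \<omega> in M. \<bar>y s \<omega>\<bar> \<le> b"
    using esssup_AE[of "\<lambda>\<omega>. ennreal \<bar>y s \<omega>\<bar>" M]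
  proof eventually_elim
    case (elim \<omega>)
    then have "ennreal \<bar>y s \<omega>\<bar> \<le> ennreal b" using Lfin by (simp add: b_def Linf_norm_def)
    then show ?case using b by simp
  qed
  have U_int: "integrable M U"
  proof (rule integrable_const_bound[where B = G])
    from yb show "AE \<omega> in M. norm (U \<omega>) \<le> G"
    proof eventually_elim
      case (elim \<omega>)
      have "\<bar>y s \<omega> / b\<bar> \<le> 1" using elim b by (cases "b = 0") (simp_all add: divide_le_eq_1)
      then show ?case unfolding U_def
        using h_bound[of "X s \<omega>"] mult_mono[of "\<bar>y s \<omega> / b\<bar>" 1 "\<bar>h (X s \<omega>)\<bar>" G]
        by (simp add: abs_mult)
    qed
  qed measurable
  \<comment> \<open>For \<open>b = 0\<close> division by \<open>b\<close> cannot be undone, but then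
    \<open>y s\<close> vanishes almost everywhere and both sides are 0.\<close>
  have eq: "AE \<omega> in M. term_at s \<omega> = b * U \<omega>"
    using yb
  proof eventually_elim
    case (elim \<omega>)
    then show ?case by (cases "b = 0") (simp_all add: U_def)
  qed
  have E: "expectation (term_at s) = b * expectation U"
    using integral_cong_AE[OF _ _ eq] by simp
  have "Linf_norm M (\<lambda>\<omega>. real_cond_exp M (past k) U \<omega> - expectation U) \<le> phi_coeff M p X y (Suc i)"
    unfolding phi_coeff_def
    by (rule SUP_upper2[where i = "(h, k, s)"]) (use s k i h in \<open>auto simp: U_def b_def Let_def\<close>)
  then have phi: "AE \<omega> in M. ennreal \<bar>real_cond_exp M (past k) U \<omega> - expectation U\<bar> \<le> phi_coeff M p X y (Suc i)"
    using esssup_AE[of "\<lambda>\<omega>. ennreal \<bar>real_cond_exp M (past k) U \<omega> - expectation U\<bar>" M]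
    unfolding Linf_norm_def by (auto elim!: eventually_mono intro: order_trans)
  have "AE \<omega> in M. real_cond_exp M (past k) (term_at s) \<omega> = real_cond_exp M (past k) (\<lambda>\<omega>. b * U \<omega>) \<omega>"
    by (rule P.real_cond_exp_cong[OF eq]) measurable
  with phi P.real_cond_exp_cmult[OF U_int, of b] show ?thesis
  proof eventually_elim
    case (elim \<omega>)
    have "\<bar>real_cond_exp M (past k) U \<omega> - expectation U\<bar> \<le> \<psi> (Suc i)"
      using enn2real_mono[OF elim(1) phi_less_top] by (simp add: \<psi>_def)
    then have "b * \<bar>real_cond_exp M (past k) U \<omega> - expectation U\<bar> \<le> B * \<psi> (Suc i)"
      using b by (intro mult_mono) auto
    then show ?case
      using elim b by (simp add: E right_diff_distrib[symmetric] abs_mult)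
  qed
qed

lemma cond_exp_past_measurable_term:
  assumes "s \<in> pos_index" "max_norm s \<le> k"
  shows "AE \<omega> in M. real_cond_exp M (past k) (term_at s) \<omega> = term_at s \<omega>"
  using assms
  by (intro sigma_finite_subalgebra.real_cond_exp_F_meas[OF sigma_finite_past]
      term_at_integrable term_at_past_measurable)

text \<open>There are three regimes: at \<open>k = max_norm s\<close> the summand is already known
  and the trivial bound applies, at \<open>k = 0\<close> the deviation is zero, and in between the
  mixing coefficient at lag \<open>max_norm s - k\<close> applies.\<close>

lemma cond_exp_dev:
  assumes s: "s \<in> pos_index" and "k \<le> max_norm s"
  shows "AE \<omega> in M. \<bar>real_cond_exp M (past k) (term_at s) \<omega> - expectation (term_at s)\<bar>
    \<le> B * \<psi> (max_norm s - k)"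
proof -
  consider "k = max_norm s" | "k = 0" "k < max_norm s" | "1 \<le> k" "k < max_norm s"
    using assms by linarith
  then show ?thesis
  proof cases
    case 1
    have "\<bar>expectation (term_at s)\<bar> \<le> B * G"
      using term_at_bound[of s] term_at_integrable[OF s]
      by (intro order_trans[OF integral_abs_bound] integral_le_const) auto
    moreover have "AE \<omega> in M. real_cond_exp M (past k) (term_at s) \<omega> = term_at s \<omega>"
      using 1 s by (intro cond_exp_past_measurable_term) auto
    ultimately show ?thesis
    proof (elim eventually_mono)
      fix \<omega> assume "\<bar>expectation (term_at s)\<bar> \<le> B * G"
        and eq: "real_cond_exp M (past k) (term_at s) \<omega> = term_at s \<omega>"
      then have "\<bar>term_at s \<omega> - expectation (term_at s)\<bar> \<le> 2 * (B * G)"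
        using term_at_bound[of s \<omega>] by linarith
      then show "\<bar>real_cond_exp M (past k) (term_at s) \<omega> - expectation (term_at s)\<bar>
        \<le> B * \<psi> (max_norm s - k)"
        using 1 eq by (simp add: \<psi>_def mult_ac)
    qed
  next
    case 2
    then show ?thesis
      using cond_exp_past_0[OF term_at_integrable[OF s]] psi_nonneg B_pos
      by (auto elim!: eventually_mono)
  next
    case 3
    then have "max_norm s = k + Suc (max_norm s - Suc k)" by simp
    from cond_exp_phi[OF s 3(1) this] 3 show ?thesis by (simp add: Suc_diff_Suc)
  qed
qed

text \<open>Once a site lies in the past, its summand no longer changes. Before that, both
  conditional expectations are compared with the mean, which produces two consecutive lags, the
  smaller possibly 0.\<close>

lemma cond_exp_increment:
  assumes s: "s \<in> pos_index"
  shows "AE \<omega> in M. \<bar>real_cond_exp M (past (Suc k)) (term_at s) \<omega> - real_cond_exp M (past k) (term_at s) \<omega>\<bar>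
    \<le> B * (if max_norm s \<le> k then 0 else \<psi> (max_norm s - Suc k) + \<psi> (max_norm s - k))"
proof (cases "max_norm s \<le> k")
  case True
  then show ?thesis
    using cond_exp_past_measurable_term[OF s, of k] cond_exp_past_measurable_term[OF s, of "Suc k"]
    by auto
next
  case False
  then have "Suc k \<le> max_norm s" "k \<le> max_norm s" by auto
  from cond_exp_dev[OF s this(1)] cond_exp_dev[OF s this(2)] show ?thesis
    by eventually_elim (use False in \<open>simp add: distrib_left\<close>)
qed

section \<open>Summation of the increments and concentration\<close>

lemma sum_psi_shift_le:
  assumes "c \<le> Suc r"
  shows "(\<Sum>k\<in>{Suc r..K}. \<psi> (k - c)) \<le> 2 * G + \<Phi>"
proof -
  have "(\<Sum>k\<in>{Suc r..K}. \<psi> (k - c)) = (\<Sum>i\<in>(\<lambda>k. k - c) ` {Suc r..K}. \<psi> i)"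
    using assms by (intro sum.reindex_cong[symmetric]) (auto intro!: inj_onI)
  also have "\<dots> \<le> (\<Sum>i\<le>K. \<psi> i)" by (intro sum_mono2) (auto simp: psi_nonneg)
  finally show ?thesis using sum_psi_le by (rule order_trans)
qed

text \<open>Summability of the mixing coefficients enters here: the bound depends neither on the
  time \<open>r\<close> nor on the number of shells \<open>K\<close>. The outer factor 2 accounts
  for the two lags.\<close>

lemma sum_increment_bound:
  "(\<Sum>k\<in>{1..K}. if k \<le> r then 0 else \<psi> (k - Suc r) + \<psi> (k - r)) \<le> 2 * (2 * G + \<Phi>)"
proof -
  have "(\<Sum>k\<in>{1..K}. if k \<le> r then 0 else \<psi> (k - Suc r) + \<psi> (k - r))
      = (\<Sum>k\<in>{Suc r..K}. \<psi> (k - Suc r) + \<psi> (k - r))"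
    by (rule sum.mono_neutral_cong_right) auto
  then show ?thesis
    using sum_psi_shift_le[of "Suc r" r K] sum_psi_shift_le[of r r K] by (simp add: sum.distrib)
qed

text \<open>The martingale has only \<open>max_norm n\<close> steps, one for each shell. Its
  increments are of the order of the number of sites divided by \<open>max_norm n\<close>, so that
  the sum of their squares leaves one factor \<open>max_norm n\<close> in the exponent.\<close>

theorem concentration:
  assumes n: "n \<in> pos_index" and t: "t > 0"
  defines "S \<equiv> \<lambda>\<omega>. \<Sum>s\<in>rect n. term_at s \<omega>"
  shows "prob {\<omega> \<in> space M. \<bar>S \<omega> - expectation S\<bar> \<ge> t * real (card (rect n))}
    \<le> 2 * exp (- (t\<^sup>2 * real (max_norm n) / (16 * B\<^sup>2 * (2 * G + \<Phi>)\<^sup>2 * (real CARD('n))\<^sup>2)))"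
proof -
  \<comment> \<open>Extension by zero outside the rectangle makes every member of the family
    integrable, as linearity of the conditional expectation for finite sums asks for.\<close>
  define V where "V s = (if s \<in> rect n then term_at s else (\<lambda>_. 0))" for s
  have pos: "s \<in> pos_index" if "s \<in> rect n" for s using that rect_subset_pos_index by blast
  have V_int: "integrable M (V s)" for s
    using term_at_integrable[OF pos] by (simp add: V_def)
  have S_V: "S = (\<lambda>\<omega>. \<Sum>s\<in>rect n. V s \<omega>)"
    unfolding S_def by (intro ext sum.cong) (auto simp: V_def)
  have S_int: "integrable M S" unfolding S_V using V_int by simp
  have cond_S: "AE \<omega> in M. real_cond_exp M (past r) S \<omega> = (\<Sum>s\<in>rect n. real_cond_exp M (past r) (term_at s) \<omega>)" for r
    using sigma_finite_subalgebra.real_cond_exp_sum[OF sigma_finite_past, of V r "rect n", OF V_int]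
    unfolding S_V[symmetric] by (simp add: V_def)
  define a where "a = real CARD('n) * real (card (rect n)) / real (max_norm n)"
  define c where "c = B * (a * (2 * (2 * G + \<Phi>)))"
  have K: "max_norm n > 0" using max_norm_ge_1[OF n] by simp
  have I: "real (card (rect n)) > 0" using card_rect_pos[OF n] by simp
  have a: "a > 0" using K I by (simp add: a_def)
  have c: "c > 0" using a B_pos G_pos Phi_nonneg by (simp add: c_def)
  have "prob {\<omega> \<in> space M. \<bar>S \<omega> - expectation S\<bar> \<ge> t * real (card (rect n))}
      \<le> 2 * exp (- ((t * real (card (rect n)))\<^sup>2 / (4 * real (max_norm n) * c\<^sup>2)))"
  proof (rule azuma_doob[where F = past])
    show "AE \<omega> in M. \<bar>real_cond_exp M (past (Suc r)) S \<omega> - real_cond_exp M (past r) S \<omega>\<bar> \<le> c" for r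
    proof -
      have "AE \<omega> in M. \<forall>s\<in>rect n.
         \<bar>real_cond_exp M (past (Suc r)) (term_at s) \<omega> - real_cond_exp M (past r) (term_at s) \<omega>\<bar>
          \<le> B * (if max_norm s \<le> r then 0 else \<psi> (max_norm s - Suc r) + \<psi> (max_norm s - r))"
        using cond_exp_increment[OF pos] by (intro AE_finite_allI finite_rect) auto
      with cond_S[of r] cond_S[of "Suc r"] show ?thesis
      proof eventually_elim
        case (elim \<omega>)
        have "\<bar>real_cond_exp M (past (Suc r)) S \<omega> - real_cond_exp M (past r) S \<omega>\<bar>
          = \<bar>\<Sum>s\<in>rect n. real_cond_exp M (past (Suc r)) (term_at s) \<omega> - real_cond_exp M (past r) (term_at s) \<omega>\<bar>"
          by (simp add: elim(1,2) sum_subtractf)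
        also have "\<dots> \<le> (\<Sum>s\<in>rect n. B * (if max_norm s \<le> r then 0 else \<psi> (max_norm s - Suc r) + \<psi> (max_norm s - r)))"
          using elim(3) by (intro order_trans[OF sum_abs] sum_mono) blast
        also have "\<dots> = B * (\<Sum>s\<in>rect n. if max_norm s \<le> r then 0 else \<psi> (max_norm s - Suc r) + \<psi> (max_norm s - r))"
          by (simp only: sum_distrib_left)
        also have "\<dots> \<le> B * (a * (\<Sum>k\<in>{1..max_norm n}. if k \<le> r then 0 else \<psi> (k - Suc r) + \<psi> (k - r)))"
          unfolding a_def using B_pos psi_nonneg
          by (intro mult_left_mono sum_rect_max_norm_le[OF n, where f = "\<lambda>k. if k \<le> r then 0 else \<psi> (k - Suc r) + \<psi> (k - r)"]) auto
        also have "\<dots> \<le> c" unfolding c_def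
          using B_pos a by (intro mult_left_mono sum_increment_bound) auto
        finally show ?case .
      qed
    qed
    show "AE \<omega> in M. real_cond_exp M (past (max_norm n)) S \<omega> = S \<omega>"
    proof -
      have "AE \<omega> in M. \<forall>s\<in>rect n. real_cond_exp M (past (max_norm n)) (term_at s) \<omega> = term_at s \<omega>"
        using cond_exp_past_measurable_term[OF pos max_norm_rect_le]
        by (intro AE_finite_allI finite_rect) auto
      with cond_S[of "max_norm n"] show ?thesis
        by eventually_elim (simp add: S_def)
    qed
  qed (use subalgebra_past past_mono S_int cond_exp_past_0 K c t I in auto)
  also have "(t * real (card (rect n)))\<^sup>2 / (4 * real (max_norm n) * c\<^sup>2)
    = t\<^sup>2 * real (max_norm n) / (16 * B\<^sup>2 * (2 * G + \<Phi>)\<^sup>2 * (real CARD('n))\<^sup>2)"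
  proof -
    define w where "w = 2 * G + \<Phi>"
    have "w > 0" using G_pos Phi_nonneg by (simp add: w_def)
    then show ?thesis unfolding c_def a_def w_def[symmetric]
      using K I B_pos by (simp add: power_mult_distrib power2_eq_square field_simps)
  qed
  finally show ?thesis .
qed

end

section \<open>Orthonormal expansions and truncation\<close>

text \<open>The library states this criterion for the sort \<open>banach\<close>, of which the sort
  \<open>{real_normed_vector, complete_space}\<close> is not an instance.\<close>

lemma integrable_if_norm_integrable:
  fixes f :: "'a \<Rightarrow> 'b::{real_normed_vector, complete_space, second_countable_topology}"
  assumes f [measurable]: "f \<in> borel_measurable M" and int: "integrable M (\<lambda>x. norm (f x))"
  shows "integrable M f"
proof -
  have fin: "(\<integral>\<^sup>+x. ennreal (norm (f x)) \<partial>M) < \<infinity>"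
    using integrableD(2)[OF int] by (simp add: top.not_eq_extremum)
  obtain u where u: "\<And>i. simple_function M (u i)"
    "\<And>x. x \<in> space M \<Longrightarrow> (\<lambda>i. u i x) \<longlonglongrightarrow> f x"
    "\<And>i x. x \<in> space M \<Longrightarrow> dist (u i x) 0 \<le> 2 * dist (f x) 0"
    using borel_measurable_implies_sequence_metric[OF f, of 0] by blast
  note u_le = u(3)[folded norm_conv_dist]
  have [measurable]: "u i \<in> borel_measurable M" for i
    by (rule borel_measurable_simple_function[OF u(1)])
  have dom: "(\<integral>\<^sup>+x. ennreal (2 * norm (f x)) \<partial>M) < \<infinity>"
    using fin by (simp add: ennreal_mult nn_integral_cmult ennreal_mult_less_top)
  have u_int: "Bochner_Integration.simple_bochner_integrable M (u i)" for i
  proof (rule simple_bochner_integrableI_bounded[OF u(1)])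
    show "(\<integral>\<^sup>+x. ennreal (norm (u i x)) \<partial>M) < \<infinity>"
      using u_le by (intro le_less_trans[OF nn_integral_mono dom] ennreal_leI)
  qed
  \<comment> \<open>This is the distance in mean from \<open>f\<close> to its simple approximations.
    It tends to 0 by dominated convergence, the approximations being bounded by
    \<open>2 * norm (f x)\<close>.\<close>
  define \<Delta> where "\<Delta> i = (\<integral>\<^sup>+x. ennreal (norm (f x - u i x)) \<partial>M)" for i
  have \<Delta>: "\<Delta> \<longlonglongrightarrow> 0"
    unfolding \<Delta>_def[abs_def]
    by (rule nn_integral_dominated_convergence_norm[OF _ _ _ _ dom]) (use u u_le in auto)
  \<comment> \<open>Two simple integrals differ by at most \<open>\<Delta> i + \<Delta> j\<close>.
    Completeness then yields the limit required in the definition of the Bochner integral.\<close>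
  have "Cauchy (\<lambda>i. Bochner_Integration.simple_bochner_integral M (u i))"
  proof (rule metric_CauchyI)
    fix r :: real assume "r > 0"
    then have "eventually (\<lambda>i. \<Delta> i < ennreal (r / 2)) sequentially"
      by (intro order_tendstoD(2)[OF \<Delta>]) simp
    then obtain N where N: "\<And>i. i \<ge> N \<Longrightarrow> \<Delta> i < ennreal (r / 2)"
      by (auto simp: eventually_sequentially)
    have "dist (Bochner_Integration.simple_bochner_integral M (u i)) (Bochner_Integration.simple_bochner_integral M (u j)) < r"
      if "i \<ge> N" "j \<ge> N" for i j
    proof -
      have "ennreal (dist (Bochner_Integration.simple_bochner_integral M (u i)) (Bochner_Integration.simple_bochner_integral M (u j))) \<le> \<Delta> i + \<Delta> j"
        unfolding dist_norm \<Delta>_def by (rule simple_bochner_integral_bounded[OF f u_int u_int])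
      also have "\<dots> < ennreal (r / 2) + ennreal (r / 2)" by (intro add_strict_mono N that)
      also have "\<dots> = ennreal r" using \<open>r > 0\<close> by (simp flip: ennreal_plus)
      finally show ?thesis by (simp add: ennreal_less_iff)
    qed
    then show "\<exists>N. \<forall>i\<ge>N. \<forall>j\<ge>N.
      dist (Bochner_Integration.simple_bochner_integral M (u i)) (Bochner_Integration.simple_bochner_integral M (u j)) < r" by blast
  qed
  then obtain x where "(\<lambda>i. Bochner_Integration.simple_bochner_integral M (u i)) \<longlonglongrightarrow> x"
    using Cauchy_convergent convergent_def by blast
  then have "has_bochner_integral M f x"
    using f u_int \<Delta> unfolding \<Delta>_def[abs_def] by (intro has_bochner_integral.intros)
  then show ?thesis by (rule integrable.intros)
qed

lemma norm_integrable_if_integrable: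
  fixes f :: "'a \<Rightarrow> 'b::{real_normed_vector, second_countable_topology}"
  assumes "integrable M f"
  shows "integrable M (\<lambda>x. norm (f x))"
proof (rule integrableI_bounded)
  show "(\<lambda>x. norm (f x)) \<in> borel_measurable M" using assms by measurable
  show "(\<integral>\<^sup>+x. ennreal (norm (norm (f x))) \<partial>M) < \<infinity>"
    using has_bochner_integral_implies_finite_norm[OF has_bochner_integral_integrable[OF assms]] by simp
qed

section \<open>Projections and Parseval's identity\<close>

lemma orthonormal_basisD:
  assumes "orthonormal_basis e" "i \<ge> 1" "j \<ge> 1"
  shows "inner (e i) (e j) = (if i = j then 1 else 0)"
  using assms by (simp add: orthonormal_basis_def)

lemma norm_sum_orthonormal:
  assumes e: "orthonormal_basis e" and "finite A" "A \<subseteq> {1..}"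
  shows "(norm (\<Sum>j\<in>A. c j *\<^sub>R e j))\<^sup>2 = (\<Sum>j\<in>A. (c j)\<^sup>2)"
proof -
  have "(norm (\<Sum>j\<in>A. c j *\<^sub>R e j))\<^sup>2 = (\<Sum>i\<in>A. \<Sum>j\<in>A. c i * (c j * inner (e i) (e j)))"
    unfolding power2_norm_eq_inner inner_sum_left inner_sum_right
    by (intro sum.cong refl) (metis inner_commute inner_scaleR_left inner_scaleR_right mult.left_commute)
  also have "\<dots> = (\<Sum>i\<in>A. \<Sum>j\<in>A. if i = j then (c i)\<^sup>2 else 0)"
    using assms by (intro sum.cong refl) (auto simp: orthonormal_basisD power2_eq_square subset_iff)
  also have "\<dots> = (\<Sum>j\<in>A. (c j)\<^sup>2)" using assms by simp
  finally show ?thesis .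
qed

text \<open>Basis indices start at 1, so \<open>proj e 0\<close> is zero and the residual for
  \<open>J = 0\<close> is the whole vector.\<close>

definition proj :: "(nat \<Rightarrow> 'h::real_inner) \<Rightarrow> nat \<Rightarrow> 'h \<Rightarrow> 'h" where
  "proj e J x = (\<Sum>j\<in>{1..J}. inner x (e j) *\<^sub>R e j)"

lemma proj_diff: "proj e J (x - y) = proj e J x - proj e J y"
  by (simp add: proj_def inner_diff_left scaleR_diff_left sum_subtractf)

lemma proj_id_on_span:
  assumes e: "orthonormal_basis e" and "v \<in> span (e ` {1..J})"
  shows "proj e J v = v"
  using assms(2)
proof (induction rule: span_induct_alt)
  case base
  show ?case by (simp add: proj_def)
next
  case (step c x y)
  then obtain i where i: "i \<in> {1..J}" "x = e i" by blast
  have "(\<Sum>j\<in>{1..J}. inner (e i) (e j) *\<^sub>R e j) = (\<Sum>j\<in>{1..J}. if i = j then e j else 0)"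
    using i e by (intro sum.cong refl) (auto simp: orthonormal_basisD)
  then have "proj e J x = x" using i by (simp add: proj_def)
  moreover have "proj e J (c *\<^sub>R x + y) = c *\<^sub>R proj e J x + proj e J y"
    by (simp add: proj_def inner_add_left scaleR_add_left sum.distrib scaleR_sum_right)
  ultimately show ?case using step by simp
qed

lemma norm_proj_residual:
  assumes e: "orthonormal_basis e"
  shows "(norm (x - proj e J x))\<^sup>2 = (norm x)\<^sup>2 - (\<Sum>j\<in>{1..J}. (inner x (e j))\<^sup>2)"
proof -
  have 1: "(norm (proj e J x))\<^sup>2 = (\<Sum>j\<in>{1..J}. (inner x (e j))\<^sup>2)"
    unfolding proj_def by (rule norm_sum_orthonormal[OF e]) auto
  have 2: "inner x (proj e J x) = (\<Sum>j\<in>{1..J}. (inner x (e j))\<^sup>2)"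
    by (simp add: proj_def inner_sum_right power2_eq_square)
  have "(norm (x - proj e J x))\<^sup>2 = (norm x)\<^sup>2 - 2 * inner x (proj e J x) + (norm (proj e J x))\<^sup>2"
    by (simp add: power2_norm_eq_inner inner_diff_left inner_diff_right inner_commute)
  then show ?thesis using 1 2 by simp
qed

lemma bessel:
  assumes "orthonormal_basis e"
  shows "(\<Sum>j\<in>{1..J}. (inner x (e j))\<^sup>2) \<le> (norm x)\<^sup>2"
  using norm_proj_residual[OF assms, of x J] by (smt (verit) zero_le_power2)

text \<open>By density some \<open>v\<close> in the span of finitely many basis vectors is close to
  \<open>x\<close>. A projection of large index fixes \<open>v\<close>, so the residual of
  \<open>x\<close> is that of \<open>x - v\<close> and is no longer than \<open>x - v\<close>.
  Monotonicity and Bessel's inequality extend this to all larger indices.\<close>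

lemma parseval:
  assumes e: "orthonormal_basis e"
  shows "(\<lambda>j. (inner x (e (Suc j)))\<^sup>2) sums (norm x)\<^sup>2"
proof -
  define s where "s J = (\<Sum>j<J. (inner x (e (Suc j)))\<^sup>2)" for J
  have s: "s J = (\<Sum>j\<in>{1..J}. (inner x (e j))\<^sup>2)" for J
    unfolding s_def by (simp add: sum.atLeast1_atMost_eq)
  have incs: "incseq s" by (auto simp: s_def incseq_def intro!: sum_mono2)
  have "s \<longlonglongrightarrow> (norm x)\<^sup>2"
  proof (rule LIMSEQ_I)
    fix r :: real assume r: "r > 0"
    have "x \<in> closure (span (e ` {1..}))" using e by (simp add: orthonormal_basis_def)
    then obtain v where v: "v \<in> span (e ` {1..})" "dist v x < sqrt r"
      using r unfolding closure_approachable by (meson real_sqrt_gt_zero)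
    obtain t where t: "finite t" "t \<subseteq> e ` {1..}" "v \<in> span t"
      using v(1) by (auto simp: span_explicit intro: span_sum span_scale span_base)
    obtain A where A: "finite A" "A \<subseteq> {1..}" "t = e ` A"
      using finite_subset_image[OF t(1,2)] by metis
    obtain J0 where "A \<subseteq> {..J0}" using A(1) finite_nat_iff_bounded_le by blast
    then have "t \<subseteq> e ` {1..J0}" using A by fastforce
    then have "v \<in> span (e ` {1..J0})" using t(3) span_mono by blast
    then have res: "x - proj e J0 x = (x - v) - proj e J0 (x - v)"
      by (simp add: proj_diff proj_id_on_span[OF e])
    have "(norm (x - proj e J0 x))\<^sup>2 \<le> (norm (x - v))\<^sup>2"
      unfolding res norm_proj_residual[OF e] by (simp add: sum_nonneg)
    also have "\<dots> < r"
      using power_strict_mono[of "norm (x - v)" "sqrt r" 2] v(2) r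
      by (simp add: dist_norm norm_minus_commute)
    finally have J0: "(norm x)\<^sup>2 - s J0 < r" by (simp add: norm_proj_residual[OF e] s)
    have "norm (s J - (norm x)\<^sup>2) < r" if "J \<ge> J0" for J
      using incseqD[OF incs that] J0 bessel[OF e, of x J] unfolding s[symmetric] real_norm_def by linarith
    then show "\<exists>no. \<forall>n\<ge>no. norm (s n - (norm x)\<^sup>2) < r" by blast
  qed
  then show ?thesis by (simp add: sums_def s_def[abs_def])
qed

lemma parseval_residual:
  assumes e: "orthonormal_basis e"
  shows "(\<lambda>j. (inner x (e (Suc (j + J))))\<^sup>2) sums (norm (x - proj e J x))\<^sup>2"
  using sums_split_initial_segment[OF parseval[OF e, of x], of J]
  by (simp add: norm_proj_residual[OF e] sum.atLeast1_atMost_eq)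

text \<open>The coordinates are clipped one by one, in agreement with
  \<open>truncated_coord\<close>, so that the truncated sum splits into \<open>J\<close> bounded
  real fields.\<close>

definition truncation :: "(nat \<Rightarrow> 'h::real_inner) \<Rightarrow> nat \<Rightarrow> real \<Rightarrow> 'h \<Rightarrow> 'h" where
  "truncation e J B x = (\<Sum>j\<in>{1..J}. min B (max (- B) (inner x (e j))) *\<^sub>R e j)"

text \<open>Each clipping error is at most the coordinate itself, so Bessel's inequality bounds
  their sum by \<open>norm x\<close>. No coordinate exceeds \<open>norm x\<close>, so nothing is
  clipped while \<open>norm x < B\<close>: one event for the norm controls all coordinates at
  once.\<close>

lemma norm_truncation_residual:
  assumes e: "orthonormal_basis e" and B: "B > 0"
  shows "norm (x - truncation e J B x) \<le> norm (x - proj e J x) + norm x * indicator {x. norm x \<ge> B} x"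
proof -
  define c where "c j = inner x (e j) - min B (max (- B) (inner x (e j)))" for j
  have eq: "x - truncation e J B x = (x - proj e J x) + (\<Sum>j\<in>{1..J}. c j *\<^sub>R e j)"
    by (simp add: truncation_def proj_def c_def scaleR_diff_left sum_subtractf)
  have n2: "(norm (\<Sum>j\<in>{1..J}. c j *\<^sub>R e j))\<^sup>2 = (\<Sum>j\<in>{1..J}. (c j)\<^sup>2)"
    by (rule norm_sum_orthonormal[OF e]) auto
  have "norm (\<Sum>j\<in>{1..J}. c j *\<^sub>R e j) \<le> norm x * indicator {x. norm x \<ge> B} x"
  proof (cases "norm x \<ge> B")
    case True
    have "(c j)\<^sup>2 \<le> (inner x (e j))\<^sup>2" for j
      unfolding abs_le_square_iff[symmetric] c_def using B by (auto simp: min_def max_def)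
    then have "(norm (\<Sum>j\<in>{1..J}. c j *\<^sub>R e j))\<^sup>2 \<le> (norm x)\<^sup>2"
      unfolding n2 by (intro order_trans[OF sum_mono bessel[OF e]])
    then have "norm (\<Sum>j\<in>{1..J}. c j *\<^sub>R e j) \<le> norm x"
      by (rule power2_le_imp_le) simp
    then show ?thesis using True by simp
  next
    case False
    have "c j = 0" if "j \<in> {1..J}" for j
    proof -
      have "inner (e j) (e j) = 1" using that orthonormal_basisD[OF e, of j j] by simp
      then have "norm (e j) = 1" by (simp only: norm_eq_1)
      then have "\<bar>inner x (e j)\<bar> \<le> norm x" using Cauchy_Schwarz_ineq2[of x "e j"] by simp
      then show ?thesis using False by (auto simp: c_def min_def max_def)
    qed
    then show ?thesis by simp
  qed
  then show ?thesis unfolding eq by (intro order_trans[OF norm_triangle_ineq]) auto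
qed

section \<open>Moments of the residuals\<close>

lemma le_weighted_square: "u \<le> u\<^sup>2 / \<delta> + \<delta>" if "\<delta> > 0" for u \<delta> :: real
proof -
  have "u * \<delta> \<le> u\<^sup>2 + \<delta>\<^sup>2"
    using sum_squares_bound[of u \<delta>] zero_le_power2[of u] zero_le_power2[of \<delta>] by linarith
  then show ?thesis using that by (simp add: field_simps power2_eq_square)
qed

text \<open>By Parseval's identity the second moment is a sum of coordinate moments beyond
  \<open>J\<close>, dominated by a geometric series with ratio \<open>exp (- d\<^sub>1)\<close>. The
  case \<open>J = 0\<close> bounds the second moment of \<open>Y\<close>.\<close>

lemma (in prob_space) proj_residual_second_moment:
  fixes Y :: "'a \<Rightarrow> 'h::{real_inner, second_countable_topology}"
  assumes e: "orthonormal_basis e" and [measurable]: "Y \<in> borel_measurable M" and d: "d\<^sub>1 > 0"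
    and mom: "\<And>j. j \<ge> 1 \<Longrightarrow> integrable M (\<lambda>\<omega>. (inner (Y \<omega>) (e j))\<^sup>2)
      \<and> expectation (\<lambda>\<omega>. (inner (Y \<omega>) (e j))\<^sup>2) \<le> d\<^sub>0 * exp (- d\<^sub>1 * real j)"
  defines "D \<equiv> \<bar>d\<^sub>0\<bar> / (1 - exp (- d\<^sub>1))"
  shows "integrable M (\<lambda>\<omega>. (norm (Y \<omega> - proj e J (Y \<omega>)))\<^sup>2)"
    and "expectation (\<lambda>\<omega>. (norm (Y \<omega> - proj e J (Y \<omega>)))\<^sup>2) \<le> D * exp (- d\<^sub>1 * real J)"
proof -
  define q where "q = exp (- d\<^sub>1)"
  have q: "0 < q" "q < 1" using d by (auto simp: q_def)
  have expq: "exp (- d\<^sub>1 * real k) = q ^ k" for k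
    by (simp add: q_def exp_of_nat_mult[symmetric] mult.commute)
  have [measurable]: "(\<lambda>\<omega>. proj e J (Y \<omega>)) \<in> borel_measurable M" unfolding proj_def by measurable
  \<comment> \<open>Working with the nonnegative integral lets sum and integral be exchanged first;
    integrability is read off from the finite bound afterwards.\<close>
  have bd: "(\<integral>\<^sup>+\<omega>. ennreal ((norm (Y \<omega> - proj e J (Y \<omega>)))\<^sup>2) \<partial>M) \<le> ennreal (D * exp (- d\<^sub>1 * real J))"
  proof -
    have "(\<integral>\<^sup>+\<omega>. ennreal ((norm (Y \<omega> - proj e J (Y \<omega>)))\<^sup>2) \<partial>M)
        = (\<integral>\<^sup>+\<omega>. (\<Sum>j. ennreal ((inner (Y \<omega>) (e (Suc (j + J))))\<^sup>2)) \<partial>M)"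
      by (intro nn_integral_cong suminf_ennreal_eq[symmetric] parseval_residual[OF e]) auto
    also have "\<dots> = (\<Sum>j. \<integral>\<^sup>+\<omega>. ennreal ((inner (Y \<omega>) (e (Suc (j + J))))\<^sup>2) \<partial>M)"
      by (rule nn_integral_suminf) measurable
    also have "\<dots> \<le> (\<Sum>j. ennreal (\<bar>d\<^sub>0\<bar> * q ^ J * q ^ j))"
    proof (intro suminf_le summableI)
      fix j
      have "(\<integral>\<^sup>+\<omega>. ennreal ((inner (Y \<omega>) (e (Suc (j + J))))\<^sup>2) \<partial>M)
          = ennreal (expectation (\<lambda>\<omega>. (inner (Y \<omega>) (e (Suc (j + J))))\<^sup>2))"
        using mom[of "Suc (j + J)"] by (intro nn_integral_eq_integral) auto
      also have "\<dots> \<le> ennreal (\<bar>d\<^sub>0\<bar> * q ^ J * q ^ j)"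
      proof (rule ennreal_leI)
        have "expectation (\<lambda>\<omega>. (inner (Y \<omega>) (e (Suc (j + J))))\<^sup>2) \<le> d\<^sub>0 * q ^ Suc (j + J)"
          using mom[of "Suc (j + J)"] unfolding expq by auto
        also have "\<dots> \<le> \<bar>d\<^sub>0\<bar> * q ^ (J + j)"
          using q by (intro mult_mono power_decreasing) auto
        finally show "expectation (\<lambda>\<omega>. (inner (Y \<omega>) (e (Suc (j + J))))\<^sup>2) \<le> \<bar>d\<^sub>0\<bar> * q ^ J * q ^ j"
          by (simp add: power_add)
      qed
      finally show "(\<integral>\<^sup>+\<omega>. ennreal ((inner (Y \<omega>) (e (Suc (j + J))))\<^sup>2) \<partial>M) \<le> ennreal (\<bar>d\<^sub>0\<bar> * q ^ J * q ^ j)" .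
    qed
    also have "\<dots> = ennreal (\<bar>d\<^sub>0\<bar> * q ^ J * (1 / (1 - q)))"
      using q by (intro suminf_ennreal_eq sums_mult geometric_sums) auto
    also have "\<bar>d\<^sub>0\<bar> * q ^ J * (1 / (1 - q)) = D * exp (- d\<^sub>1 * real J)"
      unfolding expq by (simp add: D_def q_def)
    finally show ?thesis .
  qed
  show int: "integrable M (\<lambda>\<omega>. (norm (Y \<omega> - proj e J (Y \<omega>)))\<^sup>2)"
    by (rule integrableI_bounded) (use bd in \<open>auto simp: le_less_trans\<close>)
  have "D \<ge> 0" using q by (simp add: D_def q_def)
  then show "expectation (\<lambda>\<omega>. (norm (Y \<omega> - proj e J (Y \<omega>)))\<^sup>2) \<le> D * exp (- d\<^sub>1 * real J)"
    using bd nn_integral_eq_integral[OF int] by simp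
qed

text \<open>First moments are derived from second moments by \<open>le_weighted_square\<close>, in
  the role of the Cauchy-Schwarz inequality. The weights are square roots of the exponential rates,
  hence the halved exponents.\<close>

lemma (in prob_space) truncation_residual_moment:
  fixes Y :: "'a \<Rightarrow> 'h::{real_inner, second_countable_topology}"
  assumes e: "orthonormal_basis e" and [measurable]: "Y \<in> borel_measurable M" and d: "d\<^sub>1 > 0"
    and mom: "\<And>j. j \<ge> 1 \<Longrightarrow> integrable M (\<lambda>\<omega>. (inner (Y \<omega>) (e j))\<^sup>2)
      \<and> expectation (\<lambda>\<omega>. (inner (Y \<omega>) (e j))\<^sup>2) \<le> d\<^sub>0 * exp (- d\<^sub>1 * real j)"
    and B: "B > 0" and tail: "prob {\<omega> \<in> space M. norm (Y \<omega>) \<ge> B} \<le> \<kappa> * exp (- \<rho>)"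
  defines "D \<equiv> \<bar>d\<^sub>0\<bar> / (1 - exp (- d\<^sub>1))"
  shows "integrable M (\<lambda>\<omega>. norm (Y \<omega> - truncation e J B (Y \<omega>)))"
    and "expectation (\<lambda>\<omega>. norm (Y \<omega> - truncation e J B (Y \<omega>)))
      \<le> (D + 1) * exp (- (d\<^sub>1 * real J / 2)) + (D + \<kappa>) * exp (- (\<rho> / 2))"
proof -
  let ?R = "\<lambda>\<omega>. Y \<omega> - truncation e J B (Y \<omega>)"
  define E where "E = {\<omega> \<in> space M. norm (Y \<omega>) \<ge> B}"
  have [measurable]: "E \<in> sets M" unfolding E_def by measurable
  note res = proj_residual_second_moment[OF e _ d mom]
  define \<delta> where "\<delta> = exp (- (d\<^sub>1 * real J / 2))"
  define \<eta> where "\<eta> = exp (- (\<rho> / 2))"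
  have pos: "\<delta> > 0" "\<eta> > 0" by (auto simp: \<delta>_def \<eta>_def)
  have \<delta>2: "exp (- d\<^sub>1 * real J) = \<delta> * \<delta>" and \<eta>2: "exp (- \<rho>) = \<eta> * \<eta>"
    by (auto simp: \<delta>_def \<eta>_def exp_add[symmetric])
  have [measurable]: "?R \<in> borel_measurable M" unfolding truncation_def by measurable
  \<comment> \<open>The first bracket dominates the projection residual with weight
    \<open>\<delta>\<close>. The second dominates the norm of \<open>Y\<close> on \<open>E\<close>
    with weight \<open>1 / \<eta>\<close>, and its indicator has mean of order
    \<open>\<eta>\<^sup>2\<close> by the tail condition.\<close>
  define W where "W \<omega> = ((norm (Y \<omega> - proj e J (Y \<omega>)))\<^sup>2 / \<delta> + \<delta>)
     + (\<eta> * (norm (Y \<omega>))\<^sup>2 + indicator E \<omega> / \<eta>)" for \<omega>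
  have int1: "integrable M (\<lambda>\<omega>. (norm (Y \<omega> - proj e J (Y \<omega>)))\<^sup>2)"
    and E1: "expectation (\<lambda>\<omega>. (norm (Y \<omega> - proj e J (Y \<omega>)))\<^sup>2) \<le> D * (\<delta> * \<delta>)"
    using res[of J] by (simp_all add: D_def \<delta>2[symmetric])
  have int2: "integrable M (\<lambda>\<omega>. (norm (Y \<omega>))\<^sup>2)" and E2: "expectation (\<lambda>\<omega>. (norm (Y \<omega>))\<^sup>2) \<le> D"
    using res[of 0] by (simp_all add: D_def proj_def)
  have W_int: "integrable M W"
    unfolding W_def using int1 int2 by (simp add: emeasure_eq_measure)
  have RW: "norm (?R \<omega>) \<le> W \<omega>" if "\<omega> \<in> space M" for \<omega>
  proof -
    have "norm (Y \<omega>) * indicator {x. norm x \<ge> B} (Y \<omega>) \<le> \<eta> * (norm (Y \<omega>))\<^sup>2 + indicator E \<omega> / \<eta>"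
      using le_weighted_square[of "1 / \<eta>" "norm (Y \<omega>)"] pos that
      by (auto simp: E_def indicator_def mult.commute)
    then show ?thesis
      using norm_truncation_residual[OF e B, of "Y \<omega>" J]
        le_weighted_square[OF pos(1), of "norm (Y \<omega> - proj e J (Y \<omega>))"]
      unfolding W_def by linarith
  qed
  show int: "integrable M (\<lambda>\<omega>. norm (?R \<omega>))"
  proof (rule Bochner_Integration.integrable_bound[OF W_int])
    show "AE \<omega> in M. norm (norm (?R \<omega>)) \<le> norm (W \<omega>)"
      using RW by (intro AE_I2) (fastforce intro: order_trans)
  qed measurable
  have "expectation (\<lambda>\<omega>. norm (?R \<omega>)) \<le> expectation W"
    using int W_int RW by (intro integral_mono) auto
  also have "expectation W = (expectation (\<lambda>\<omega>. (norm (Y \<omega> - proj e J (Y \<omega>)))\<^sup>2) / \<delta> + \<delta>)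
     + (\<eta> * expectation (\<lambda>\<omega>. (norm (Y \<omega>))\<^sup>2) + prob E / \<eta>)"
    unfolding W_def using int1 int2 by (simp add: emeasure_eq_measure prob_space)
  also have "\<dots> \<le> (D * (\<delta> * \<delta>) / \<delta> + \<delta>) + (\<eta> * D + \<kappa> * (\<eta> * \<eta>) / \<eta>)"
    using E1 E2 tail pos unfolding E_def[symmetric] \<eta>2
    by (intro add_mono mult_left_mono divide_right_mono) auto
  also have "\<dots> = (D + 1) * \<delta> + (D + \<kappa>) * \<eta>" using pos by (simp add: field_simps)
  finally show "expectation (\<lambda>\<omega>. norm (?R \<omega>)) \<le>
    (D + 1) * exp (- (d\<^sub>1 * real J / 2)) + (D + \<kappa>) * exp (- (\<rho> / 2))"
    by (simp only: \<delta>_def \<eta>_def)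
qed

section \<open>Mixing fields in a Hilbert space\<close>

text \<open>The tail condition is stated separately in the results below, because they are applied
  with two different tail exponents.\<close>

locale mixing_hilbert_field = prob_space M for M :: "'w measure" +
  fixes X :: "nat ^ 'n::finite \<Rightarrow> 'w \<Rightarrow> 's::topological_space"
    and Y :: "nat ^ 'n \<Rightarrow> 'w \<Rightarrow> 'h::{real_inner, complete_space, second_countable_topology}"
    and e :: "nat \<Rightarrow> 'h"
    and p :: "('s \<Rightarrow> real) \<Rightarrow> ennreal"
    and g :: "'s \<Rightarrow> real"
    and d\<^sub>0 d\<^sub>1 G \<Phi> :: real
  assumes basis: "orthonormal_basis e"
    and X_meas: "s \<in> pos_index \<Longrightarrow> X s \<in> borel_measurable M"
    and Y_meas: "s \<in> pos_index \<Longrightarrow> Y s \<in> borel_measurable M"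
    and d\<^sub>1_pos: "d\<^sub>1 > 0"
    and moments: "s \<in> pos_index \<Longrightarrow> j \<ge> 1 \<Longrightarrow> integrable M (\<lambda>\<omega>. (inner (Y s \<omega>) (e j))\<^sup>2)
      \<and> expectation (\<lambda>\<omega>. (inner (Y s \<omega>) (e j))\<^sup>2) \<le> d\<^sub>0 * exp (- d\<^sub>1 * real j)"
    and g_class: "g \<in> unit_class p"
    and g_bound: "\<bar>g x\<bar> \<le> G"
    and phi_sums: "j \<ge> 1 \<Longrightarrow> B > 0 \<Longrightarrow>
      (\<Sum>i. phi_coeff M p X (truncated_coord e Y j B) (Suc i)) \<le> ennreal \<Phi>"
    and G_positive: "G > 0" and Phi_nonnegative: "\<Phi> \<ge> 0"
begin

definition D :: real where "D = \<bar>d\<^sub>0\<bar> / (1 - exp (- d\<^sub>1))"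

lemma D_nonneg: "D \<ge> 0"
  using d\<^sub>1_pos by (simp add: D_def)

lemma g_meas [measurable]: "g \<in> borel_measurable borel"
  using g_class by (simp add: unit_class_def bounded_funs_def)

lemma coordinate_field:
  assumes "j \<ge> 1" "B > 0"
  shows "bounded_mixing_field M X (truncated_coord e Y j B) p g B G \<Phi>"
proof
  show "truncated_coord e Y j B s \<in> borel_measurable M" if "s \<in> pos_index" for s
    using Y_meas[OF that] unfolding truncated_coord_def[abs_def] by measurable
  show "\<bar>truncated_coord e Y j B s \<omega>\<bar> \<le> B" for s \<omega>
    using assms(2) by (auto simp: truncated_coord_def)
qed (use assms X_meas g_class g_bound phi_sums G_positive Phi_nonnegative in auto)

text \<open>Markov's inequality: centring at most doubles the first moment, the threshold is half of
  \<open>\<epsilon>\<close> times the number of sites, and this number cancels, which leaves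
  \<open>4 * G / \<epsilon>\<close>.\<close>

lemma residual_sum_tail:
  fixes J :: nat
  assumes n: "n \<in> pos_index" and B: "B > 0" and \<epsilon>: "\<epsilon> > 0"
    and tail: "\<And>s. s \<in> pos_index \<Longrightarrow> prob {\<omega> \<in> space M. norm (Y s \<omega>) \<ge> B} \<le> \<kappa> * exp (- \<rho>)"
  defines "R \<equiv> \<lambda>\<omega>. \<Sum>s\<in>rect n. g (X s \<omega>) *\<^sub>R (Y s \<omega> - truncation e J B (Y s \<omega>))"
  shows "integrable M R"
    and "prob {\<omega> \<in> space M. norm (R \<omega> - expectation R) \<ge> \<epsilon> * real (card (rect n)) / 2}
      \<le> 4 * G / \<epsilon> * ((D + 1) * exp (- (d\<^sub>1 * real J / 2)) + (D + \<kappa>) * exp (- (\<rho> / 2)))"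
proof -
  define r where "r = (D + 1) * exp (- (d\<^sub>1 * real J / 2)) + (D + \<kappa>) * exp (- (\<rho> / 2))"
  define I where "I = real (card (rect n))"
  have I: "I > 0" using card_rect_pos[OF n] by (simp add: I_def)
  let ?R = "\<lambda>s \<omega>. Y s \<omega> - truncation e J B (Y s \<omega>)"
  have summand: "integrable M (\<lambda>\<omega>. norm (g (X s \<omega>) *\<^sub>R ?R s \<omega>))"
    "expectation (\<lambda>\<omega>. norm (g (X s \<omega>) *\<^sub>R ?R s \<omega>)) \<le> G * r"
    "(\<lambda>\<omega>. g (X s \<omega>) *\<^sub>R ?R s \<omega>) \<in> borel_measurable M"
    if "s \<in> rect n" for s
  proof -
    have s: "s \<in> pos_index" using that rect_subset_pos_index by blast
    note [measurable] = X_meas[OF s] Y_meas[OF s]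
    note res = truncation_residual_moment[OF basis Y_meas[OF s] d\<^sub>1_pos moments[OF s] B tail[OF s], of J]
    show [measurable]: "(\<lambda>\<omega>. g (X s \<omega>) *\<^sub>R ?R s \<omega>) \<in> borel_measurable M"
      unfolding truncation_def by measurable
    have le: "norm (g (X s \<omega>) *\<^sub>R ?R s \<omega>) \<le> G * norm (?R s \<omega>)" for \<omega>
      using g_bound[of "X s \<omega>"] by (simp add: mult_right_mono)
    have Gint: "integrable M (\<lambda>\<omega>. G * norm (?R s \<omega>))" using res(1) by simp
    show int: "integrable M (\<lambda>\<omega>. norm (g (X s \<omega>) *\<^sub>R ?R s \<omega>))"
    proof (rule Bochner_Integration.integrable_bound[OF Gint])
      show "AE \<omega> in M. norm (norm (g (X s \<omega>) *\<^sub>R ?R s \<omega>)) \<le> norm (G * norm (?R s \<omega>))"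
        using le by (intro AE_I2) (metis abs_of_nonneg norm_ge_zero order_trans real_norm_def abs_ge_self)
    qed measurable
    have "expectation (\<lambda>\<omega>. norm (g (X s \<omega>) *\<^sub>R ?R s \<omega>)) \<le> expectation (\<lambda>\<omega>. G * norm (?R s \<omega>))"
      by (rule integral_mono[OF int Gint le])
    also have "\<dots> \<le> G * r"
      using res(2) G_positive by (simp add: r_def D_def)
    finally show "expectation (\<lambda>\<omega>. norm (g (X s \<omega>) *\<^sub>R ?R s \<omega>)) \<le> G * r" .
  qed
  have R_meas [measurable]: "R \<in> borel_measurable M"
    unfolding R_def using summand(3) by (intro borel_measurable_sum)
  show R_int: "integrable M R"
    unfolding R_def
    by (rule Bochner_Integration.integrable_sum, rule integrable_if_norm_integrable) (use summand in auto)
  have nR_int: "integrable M (\<lambda>\<omega>. norm (R \<omega>))" using R_int by (rule norm_integrable_if_integrable)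
  have "expectation (\<lambda>\<omega>. norm (R \<omega>)) \<le> expectation (\<lambda>\<omega>. \<Sum>s\<in>rect n. norm (g (X s \<omega>) *\<^sub>R ?R s \<omega>))"
    using nR_int summand(1) unfolding R_def
    by (intro integral_mono Bochner_Integration.integrable_sum norm_sum)
  also have "\<dots> = (\<Sum>s\<in>rect n. expectation (\<lambda>\<omega>. norm (g (X s \<omega>) *\<^sub>R ?R s \<omega>)))"
    using summand(1) by (intro Bochner_Integration.integral_sum)
  also have "\<dots> \<le> (\<Sum>s\<in>rect n. G * r)" by (intro sum_mono summand(2))
  finally have ER: "expectation (\<lambda>\<omega>. norm (R \<omega>)) \<le> I * (G * r)" by (simp add: I_def)
  have "ennreal (norm (expectation R)) \<le> ennreal (expectation (\<lambda>\<omega>. norm (R \<omega>)))"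
    using integral_norm_bound_ennreal[OF R_int] nn_integral_eq_integral[OF nR_int] by simp
  then have nE: "norm (expectation R) \<le> expectation (\<lambda>\<omega>. norm (R \<omega>))"
    by (subst (asm) ennreal_le_iff) auto
  have dev_int: "integrable M (\<lambda>\<omega>. norm (R \<omega> - expectation R))"
    using R_int by (intro norm_integrable_if_integrable) simp
  have "prob {\<omega> \<in> space M. norm (R \<omega> - expectation R) \<ge> \<epsilon> * I / 2}
      \<le> expectation (\<lambda>\<omega>. norm (R \<omega> - expectation R)) / (\<epsilon> * I / 2)"
    by (rule integral_Markov_inequality_measure[where A = "{}"]) (use dev_int \<epsilon> I in auto)
  also have "expectation (\<lambda>\<omega>. norm (R \<omega> - expectation R))
      \<le> expectation (\<lambda>\<omega>. norm (R \<omega>) + norm (expectation R))"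
    using dev_int nR_int by (intro integral_mono norm_triangle_ineq4) auto
  also have "\<dots> \<le> 2 * (I * (G * r))"
    using nR_int nE ER by (simp add: prob_space)
  finally have "prob {\<omega> \<in> space M. norm (R \<omega> - expectation R) \<ge> \<epsilon> * I / 2}
      \<le> 2 * (I * (G * r)) / (\<epsilon> * I / 2)"
    using \<epsilon> I by (simp add: divide_right_mono)
  also have "\<dots> = 4 * G / \<epsilon> * r" using \<epsilon> I by (simp add: field_simps)
  finally show "prob {\<omega> \<in> space M. norm (R \<omega> - expectation R) \<ge> \<epsilon> * real (card (rect n)) / 2}
      \<le> 4 * G / \<epsilon> * ((D + 1) * exp (- (d\<^sub>1 * real J / 2)) + (D + \<kappa>) * exp (- (\<rho> / 2)))"
    by (simp only: I_def r_def)
qed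

text \<open>The deviation is split evenly between the truncated part \<open>T\<close>, handled by a
  union bound over its \<open>J\<close> coordinates, and the residual \<open>R\<close>.\<close>

lemma deviation_bound:
  fixes J :: nat
  assumes n: "n \<in> pos_index" and B: "B > 0" and \<epsilon>: "\<epsilon> > 0" and J: "J \<ge> 1"
    and tail: "\<And>s. s \<in> pos_index \<Longrightarrow> prob {\<omega> \<in> space M. norm (Y s \<omega>) \<ge> B} \<le> \<kappa> * exp (- \<rho>)"
  defines "S \<equiv> field_sum X Y g n" and "I \<equiv> real (card (rect n))"
  shows "prob {\<omega> \<in> space M. inverse I * norm (S \<omega> - expectation S) \<ge> \<epsilon>}
    \<le> 2 * real J * exp (- (\<epsilon>\<^sup>2 * real (max_norm n) / (64 * real J * B\<^sup>2 * (2 * G + \<Phi>)\<^sup>2 * (real CARD('n))\<^sup>2)))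
      + 4 * G / \<epsilon> * ((D + 1) * exp (- (d\<^sub>1 * real J / 2)) + (D + \<kappa>) * exp (- (\<rho> / 2)))"
proof -
  have I: "I > 0" using card_rect_pos[OF n] by (simp add: I_def)
  \<comment> \<open>With this level, \<open>J\<close> orthogonal coordinates each deviating by less
    than \<open>t * I\<close> add up to a vector of norm at most
    \<open>\<epsilon> * I / 2\<close>.\<close>
  define t where "t = \<epsilon> / (2 * sqrt (real J))"
  have t: "t > 0" using \<epsilon> J by (simp add: t_def)
  define R where "R = (\<lambda>\<omega>. \<Sum>s\<in>rect n. g (X s \<omega>) *\<^sub>R (Y s \<omega> - truncation e J B (Y s \<omega>)))"
  define C where "C j = (\<lambda>\<omega>. \<Sum>s\<in>rect n. truncated_coord e Y j B s \<omega> * g (X s \<omega>))" for j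
  define T where "T \<omega> = (\<Sum>j\<in>{1..J}. C j \<omega> *\<^sub>R e j)" for \<omega>
  have R_int: "integrable M R" unfolding R_def by (rule residual_sum_tail[OF n B \<epsilon> tail])
  have C_int: "integrable M (C j)" if "j \<in> {1..J}" for j
  proof -
    interpret bounded_mixing_field M X "truncated_coord e Y j B" p g B G \<Phi>
      using that B by (intro coordinate_field) auto
    show ?thesis unfolding C_def
      using rect_subset_pos_index by (intro Bochner_Integration.integrable_sum term_at_integrable) blast
  qed
  have S_eq: "S = (\<lambda>\<omega>. T \<omega> + R \<omega>)"
  proof
    fix \<omega>
    have "T \<omega> = (\<Sum>s\<in>rect n. g (X s \<omega>) *\<^sub>R truncation e J B (Y s \<omega>))"
      unfolding T_def C_def truncation_def truncated_coord_def scaleR_sum_left scaleR_sum_right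
      by (subst sum.swap) (simp add: mult.commute)
    then show "S \<omega> = T \<omega> + R \<omega>"
      by (simp add: S_def field_sum_def R_def scaleR_diff_right sum_subtractf)
  qed
  have T_int: "integrable M T"
    unfolding T_def using C_int by (intro Bochner_Integration.integrable_sum integrable_scaleR_left)
  have ET: "expectation T = (\<Sum>j\<in>{1..J}. expectation (C j) *\<^sub>R e j)"
    unfolding T_def using C_int by (subst Bochner_Integration.integral_sum) auto
  have ES: "expectation S = expectation T + expectation R"
    unfolding S_eq using T_int R_int by simp
  define U where "U j = {\<omega> \<in> space M. \<bar>C j \<omega> - expectation (C j)\<bar> \<ge> t * I}" for j
  define V where "V = {\<omega> \<in> space M. norm (R \<omega> - expectation R) \<ge> \<epsilon> * I / 2}"
  have U_meas: "U j \<in> sets M" if "j \<in> {1..J}" for j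
  proof -
    have [measurable]: "C j \<in> borel_measurable M" using C_int[OF that] by simp
    show ?thesis unfolding U_def by measurable
  qed
  have V_meas: "V \<in> sets M"
  proof -
    have [measurable]: "R \<in> borel_measurable M" using R_int by simp
    show ?thesis unfolding V_def by measurable
  qed
  have "{\<omega> \<in> space M. inverse I * norm (S \<omega> - expectation S) \<ge> \<epsilon>} \<subseteq> (\<Union>j\<in>{1..J}. U j) \<union> V"
  proof (rule subsetI, rule ccontr)
    fix \<omega> assume \<omega>: "\<omega> \<in> {\<omega> \<in> space M. inverse I * norm (S \<omega> - expectation S) \<ge> \<epsilon>}"
      and not: "\<omega> \<notin> (\<Union>j\<in>{1..J}. U j) \<union> V"
    have R_small: "norm (R \<omega> - expectation R) < \<epsilon> * I / 2"
      using \<omega> not by (auto simp: V_def)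
    have C_small: "\<bar>C j \<omega> - expectation (C j)\<bar> < t * I" if "j \<in> {1..J}" for j
      using \<omega> not that by (force simp: U_def)
    have "(norm (T \<omega> - expectation T))\<^sup>2 = (\<Sum>j\<in>{1..J}. (C j \<omega> - expectation (C j))\<^sup>2)"
      unfolding ET T_def sum_subtractf[symmetric] scaleR_diff_left[symmetric]
      by (rule norm_sum_orthonormal[OF basis]) auto
    also have "\<dots> \<le> (\<Sum>j\<in>{1..J}. (t * I)\<^sup>2)"
    proof (rule sum_mono)
      fix j assume "j \<in> {1..J}"
      from C_small[OF this] have "\<bar>C j \<omega> - expectation (C j)\<bar> \<le> \<bar>t * I\<bar>" by linarith
      then show "(C j \<omega> - expectation (C j))\<^sup>2 \<le> (t * I)\<^sup>2" by (simp only: abs_le_square_iff)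
    qed
    also have "\<dots> = (\<epsilon> * I / 2)\<^sup>2"
      using J by (simp add: t_def power_mult_distrib power_divide)
    finally have "norm (T \<omega> - expectation T) \<le> \<epsilon> * I / 2"
      by (rule power2_le_imp_le) (use \<epsilon> I in simp)
    moreover have "norm (S \<omega> - expectation S) \<le> norm (T \<omega> - expectation T) + norm (R \<omega> - expectation R)"
      unfolding ES using norm_triangle_ineq[of "T \<omega> - expectation T" "R \<omega> - expectation R"]
      by (simp add: S_eq algebra_simps)
    ultimately have "norm (S \<omega> - expectation S) < \<epsilon> * I" using R_small by linarith
    moreover have "\<epsilon> * I \<le> norm (S \<omega> - expectation S)"
      using \<omega> I by (simp add: field_simps)
    ultimately show False by linarith
  qed
  then have "prob {\<omega> \<in> space M. inverse I * norm (S \<omega> - expectation S) \<ge> \<epsilon>} \<le> prob ((\<Union>j\<in>{1..J}. U j) \<union> V)"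
    using U_meas V_meas by (intro finite_measure_mono) auto
  also have "\<dots> \<le> prob (\<Union>j\<in>{1..J}. U j) + prob V"
    using U_meas V_meas by (intro measure_Un_le) auto
  also have "prob (\<Union>j\<in>{1..J}. U j) \<le> (\<Sum>j\<in>{1..J}. prob (U j))"
    using U_meas by (intro measure_UNION_le) auto
  also have "\<dots> \<le> (\<Sum>j\<in>{1..J}. 2 * exp (- (t\<^sup>2 * real (max_norm n) / (16 * B\<^sup>2 * (2 * G + \<Phi>)\<^sup>2 * (real CARD('n))\<^sup>2))))"
  proof (rule sum_mono)
    fix j assume "j \<in> {1..J}"
    then interpret bounded_mixing_field M X "truncated_coord e Y j B" p g B G \<Phi>
      using B by (intro coordinate_field) auto
    show "prob (U j) \<le> 2 * exp (- (t\<^sup>2 * real (max_norm n) / (16 * B\<^sup>2 * (2 * G + \<Phi>)\<^sup>2 * (real CARD('n))\<^sup>2)))"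
      unfolding U_def C_def I_def by (rule concentration[OF n t])
  qed
  also have "t\<^sup>2 = \<epsilon>\<^sup>2 / (4 * real J)" using J by (simp add: t_def power_divide power_mult_distrib)
  also have "\<epsilon>\<^sup>2 / (4 * real J) * real (max_norm n) / (16 * B\<^sup>2 * (2 * G + \<Phi>)\<^sup>2 * (real CARD('n))\<^sup>2)
    = \<epsilon>\<^sup>2 * real (max_norm n) / (64 * real J * B\<^sup>2 * (2 * G + \<Phi>)\<^sup>2 * (real CARD('n))\<^sup>2)"
    by (simp add: mult_ac)
  also have "prob V \<le> 4 * G / \<epsilon> * ((D + 1) * exp (- (d\<^sub>1 * real J / 2)) + (D + \<kappa>) * exp (- (\<rho> / 2)))"
    unfolding V_def R_def I_def by (rule residual_sum_tail[OF n B \<epsilon> tail])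
  finally show ?thesis by (simp add: mult_ac)
qed

text \<open>Here \<open>q\<close> stands for the seminorm of \<open>g\<close>, at most 1 on the unit
  class. The constants may depend on it, but not on the rectangle or on \<epsilon>.\<close>

theorem exponential_bound:
  assumes tail: "\<And>s z. s \<in> pos_index \<Longrightarrow> z \<ge> 0 \<Longrightarrow>
      prob {\<omega> \<in> space M. norm (Y s \<omega>) \<ge> z} \<le> \<kappa>\<^sub>0 * exp (- \<kappa>\<^sub>1 * z powr \<gamma>)"
    and pos: "\<kappa>\<^sub>0 > 0" "\<kappa>\<^sub>1 > 0" "\<gamma> > 0" and q: "0 < q" "q \<le> 1"
  shows "\<exists>A\<^sub>1>0. \<exists>A\<^sub>2>0. \<forall>n\<in>pos_index. \<forall>\<epsilon>>0.
    (let S = field_sum X Y g n;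
         I = real (card (rect n));
         m = (\<epsilon>\<^sup>2 * (I powr (1 / real CARD('n)) * inverse q)) powr (\<gamma> / (2 + 2 * \<gamma>))
     in prob {\<omega> \<in> space M. inverse I * norm (S \<omega> - expectation S) \<ge> \<epsilon>}
       \<le> A\<^sub>1 * (\<epsilon> powr (- 2) + m) * exp (- A\<^sub>2 * m))"
proof -
  define w where "w = (2 * G + \<Phi>)\<^sup>2 * (real CARD('n))\<^sup>2"
  have w: "w > 0" using G_positive Phi_nonnegative by (simp add: w_def add_pos_nonneg)
  \<comment> \<open>The factor \<open>q\<close> offsets the inverse seminorm in the rate, and 128 is
    the 64 of \<open>deviation_bound\<close> doubled because \<open>J\<close> is at most
    \<open>2 * m\<close>.\<close>
  define a where "a = q / (128 * w)"
  have a: "a > 0" using q w by (simp add: a_def)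
  define A\<^sub>2 where "A\<^sub>2 = min a (min (d\<^sub>1 / 2) (\<kappa>\<^sub>1 / 2))"
  have A\<^sub>2: "A\<^sub>2 > 0" "A\<^sub>2 \<le> a" "A\<^sub>2 \<le> d\<^sub>1 / 2" "A\<^sub>2 \<le> \<kappa>\<^sub>1 / 2"
    using a d\<^sub>1_pos pos by (auto simp: A\<^sub>2_def)
  define c where "c = 4 * G * (2 * D + 1 + \<kappa>\<^sub>0)"
  have c: "c \<ge> 0" using G_positive D_nonneg pos by (simp add: c_def)
  \<comment> \<open>The summands pay for the union bound, for the residual, and for the case
    \<open>m < 1\<close>, in this order.\<close>
  define A\<^sub>1 where "A\<^sub>1 = 4 + c + exp A\<^sub>2"
  have A\<^sub>1: "A\<^sub>1 > 0" using c by (simp add: A\<^sub>1_def add_nonneg_pos)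
  have main: "prob {\<omega> \<in> space M. inverse (real (card (rect n))) *
          norm (field_sum X Y g n \<omega> - expectation (field_sum X Y g n)) \<ge> \<epsilon>}
      \<le> A\<^sub>1 * (\<epsilon> powr (- 2) + m) * exp (- A\<^sub>2 * m)"
    if n: "n \<in> pos_index" and \<epsilon>: "\<epsilon> > 0"
      and m_def: "m = (\<epsilon>\<^sup>2 * (real (card (rect n)) powr (1 / real CARD('n)) * inverse q)) powr (\<gamma> / (2 + 2 * \<gamma>))"
    for n :: "nat ^ 'n" and \<epsilon> m :: real
  proof -
    define I where "I = real (card (rect n))"
    define K where "K = real (max_norm n)"
    define T where "T = I powr (1 / real CARD('n)) * inverse q"
    have m: "m = (\<epsilon>\<^sup>2 * T) powr (\<gamma> / (2 + 2 * \<gamma>))" by (simp add: m_def T_def I_def)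
    have I1: "I \<ge> 1" using card_rect_pos[OF n] by (simp add: I_def)
    have IL: "I powr (1 / real CARD('n)) \<ge> 1" using I1 by (simp add: ge_one_powr_ge_zero)
    have T1: "T \<ge> 1"
      unfolding T_def using mult_mono[OF IL, of 1 "inverse q"] q by (simp add: one_le_inverse)
    have K1: "K > 0" using max_norm_ge_1[OF n] by (simp add: K_def)
    \<comment> \<open>A rectangle with longest side \<open>K\<close> has at most
      \<open>K ^ CARD('n)\<close> sites, so the root of \<open>I\<close> is at most
      \<open>K\<close>.\<close>
    have TK: "T * q \<le> K"
    proof -
      have "I \<le> K ^ CARD('n)"
        using card_rect_le_power[of n] unfolding I_def K_def by (metis of_nat_le_iff of_nat_power)
      then have "I powr (1 / real CARD('n)) \<le> (K ^ CARD('n)) powr (1 / real CARD('n))"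
        using I1 by (intro powr_mono2) auto
      also have "\<dots> = K" using K1 by (simp add: powr_realpow[symmetric] powr_powr)
      finally show ?thesis using q by (simp add: T_def mult.assoc)
    qed
    have eps2: "\<epsilon> powr (- 2) = 1 / \<epsilon>\<^sup>2" using \<epsilon> by (simp add: powr_minus_divide)
    have m0: "m > 0" using \<epsilon> T1 by (simp add: m)
    have big: "m \<ge> 1" if "\<epsilon> \<ge> 1"
    proof -
      have "1 \<le> \<epsilon>\<^sup>2 * T" using that T1 mult_mono[of 1 "\<epsilon>\<^sup>2" 1 T] by (simp add: one_le_power)
      then show ?thesis unfolding m using pos by (intro ge_one_powr_ge_zero) auto
    qed
    show ?thesis
    proof (cases "m \<ge> 1")
      case False
      \<comment> \<open>For \<open>m < 1\<close> the claimed bound is at least 1: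
        \<open>\<epsilon> powr (- 2)\<close> exceeds 1, and \<open>exp A\<^sub>2\<close> makes up
        for the exponential.\<close>
      then have "\<epsilon> < 1" using big by linarith
      then have "\<epsilon> powr (- 2) \<ge> 1" using \<epsilon> unfolding eps2 by (simp add: power_le_one)
      then have "1 \<le> \<epsilon> powr (- 2) + m" using m0 by linarith
      moreover have "1 \<le> exp A\<^sub>2 * exp (- A\<^sub>2 * m)"
        using False A\<^sub>2(1) by (simp add: exp_add[symmetric])
      moreover have "exp A\<^sub>2 * exp (- A\<^sub>2 * m) \<le> A\<^sub>1 * exp (- A\<^sub>2 * m)"
        using c by (simp add: A\<^sub>1_def)
      ultimately have "1 \<le> (A\<^sub>1 * exp (- A\<^sub>2 * m)) * (\<epsilon> powr (- 2) + m)"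
        using mult_mono[of 1 "A\<^sub>1 * exp (- A\<^sub>2 * m)" 1 "\<epsilon> powr (- 2) + m"] by linarith
      then show ?thesis using prob_le_1 by (simp only: mult_ac) (rule order_trans)
    next
      case True
      define J where "J = nat \<lceil>m\<rceil>"
      define B where "B = m powr (1 / \<gamma>)"
      have J: "J \<ge> 1" "m \<le> real J" "real J \<le> 2 * m" using True unfolding J_def by linarith+
      have B: "B > 0" using m0 by (simp add: B_def)
      have B\<gamma>: "B powr \<gamma> = m" using m0 pos by (simp add: B_def powr_powr)
      \<comment> \<open>This balance explains the exponent \<gamma> / (2 + 2 \<gamma>): with
        \<open>J\<close> of order \<open>m\<close> and \<open>B powr \<gamma> = m\<close>, the Azuma
        exponent is of order \<open>m\<^sup>2 * B\<^sup>2 / (J * B\<^sup>2)\<close>, hence of order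
        \<open>m\<close>.\<close>
      have mB: "\<epsilon>\<^sup>2 * T = m\<^sup>2 * B\<^sup>2"
      proof -
        have "m powr ((2 + 2 * \<gamma>) / \<gamma>) = (\<epsilon>\<^sup>2 * T) powr (\<gamma> / (2 + 2 * \<gamma>) * ((2 + 2 * \<gamma>) / \<gamma>))"
          unfolding m by (rule powr_powr)
        also have "\<gamma> / (2 + 2 * \<gamma>) * ((2 + 2 * \<gamma>) / \<gamma>) = 1" using pos by simp
        finally have "\<epsilon>\<^sup>2 * T = m powr ((2 + 2 * \<gamma>) / \<gamma>)" using T1 \<epsilon> by simp
        also have "\<dots> = m powr (2 + 2 / \<gamma>)" using pos by (simp add: add_divide_distrib add.commute)
        also have "\<dots> = m powr 2 * (m powr (1 / \<gamma>)) powr 2" by (simp add: powr_add powr_powr)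
        also have "\<dots> = m\<^sup>2 * B\<^sup>2" using m0 by (simp add: B_def)
        finally show ?thesis .
      qed
      have tailB: "prob {\<omega> \<in> space M. norm (Y s \<omega>) \<ge> B} \<le> \<kappa>\<^sub>0 * exp (- (\<kappa>\<^sub>1 * m))" if "s \<in> pos_index" for s
        using tail[OF that, of B] B by (simp add: B\<gamma>)
      define x where "x = \<epsilon>\<^sup>2 * K / (64 * real J * B\<^sup>2 * (2 * G + \<Phi>)\<^sup>2 * (real CARD('n))\<^sup>2)"
      have x: "a * m \<le> x"
      proof -
        have "a * m = m\<^sup>2 * B\<^sup>2 * q / (64 * (2 * m) * B\<^sup>2 * w)"
          using m0 B w by (simp add: a_def field_simps power2_eq_square)
        also have "\<dots> = \<epsilon>\<^sup>2 * (T * q) / (64 * (2 * m) * B\<^sup>2 * w)"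
          unfolding mB[symmetric] by (simp only: mult.assoc)
        also have "\<dots> \<le> \<epsilon>\<^sup>2 * K / (64 * real J * B\<^sup>2 * w)"
          using TK J m0 B w K1
          by (intro frac_le mult_left_mono mult_right_mono) auto
        also have "\<dots> = x" by (simp add: x_def w_def mult_ac)
        finally show ?thesis .
      qed
      define E where "E = exp (- A\<^sub>2 * m)"
      have E0: "E > 0" by (simp add: E_def)
      have e1: "exp (- x) \<le> E" using order_trans[OF mult_right_mono[OF A\<^sub>2(2)] x] m0 by (simp add: E_def)
      have e2: "exp (- (d\<^sub>1 * real J / 2)) \<le> E"
        using mult_mono[OF A\<^sub>2(3) J(2)] m0 d\<^sub>1_pos by (simp add: E_def)
      have e3: "exp (- (\<kappa>\<^sub>1 * m / 2)) \<le> E"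
        using mult_right_mono[OF A\<^sub>2(4) less_imp_le[OF m0]] by (simp add: E_def)
      have "prob {\<omega> \<in> space M. inverse I * norm (field_sum X Y g n \<omega> - expectation (field_sum X Y g n)) \<ge> \<epsilon>}
        \<le> 2 * real J * exp (- x) + 4 * G / \<epsilon> * ((D + 1) * exp (- (d\<^sub>1 * real J / 2)) + (D + \<kappa>\<^sub>0) * exp (- (\<kappa>\<^sub>1 * m / 2)))"
        unfolding I_def x_def K_def by (rule deviation_bound[OF n B \<epsilon> J(1) tailB])
      also have "\<dots> \<le> 2 * (2 * m) * E + 4 * G / \<epsilon> * ((D + 1) * E + (D + \<kappa>\<^sub>0) * E)"
        using J(3) e1 e2 e3 m0 \<epsilon> G_positive D_nonneg pos
        by (intro add_mono mult_mono mult_left_mono) auto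
      also have "\<dots> = (4 * m + c * (1 / \<epsilon>)) * E" by (simp add: c_def algebra_simps)
      also have "\<dots> \<le> (4 * (\<epsilon> powr (- 2) + m) + c * (\<epsilon> powr (- 2) + m)) * E"
      proof (intro mult_right_mono add_mono mult_left_mono c)
        \<comment> \<open>The factor from Markov's inequality is absorbed by
          \<open>m \<ge> 1\<close> for large \<epsilon> and by \<open>\<epsilon> powr (- 2)\<close>
          for small \<epsilon>.\<close>
        show "1 / \<epsilon> \<le> \<epsilon> powr (- 2) + m"
        proof (cases "\<epsilon> \<ge> 1")
          case True
          then have "1 / \<epsilon> \<le> 1" by simp
          then show ?thesis using big[OF True] powr_ge_zero[of \<epsilon> "- 2"] by linarith
        next
          case False
          then have "1 / \<epsilon> \<le> 1 / \<epsilon>\<^sup>2" using \<epsilon>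
            by (intro divide_left_mono) (auto simp: power2_eq_square)
          then show ?thesis using m0 unfolding eps2 by linarith
        qed
      qed (use E0 in auto)
      also have "\<dots> = (4 + c) * (\<epsilon> powr (- 2) + m) * E" by (simp add: algebra_simps)
      also have "\<dots> \<le> A\<^sub>1 * (\<epsilon> powr (- 2) + m) * E"
        using m0 E0 by (intro mult_right_mono) (auto simp: A\<^sub>1_def)
      finally show ?thesis by (simp only: I_def E_def)
    qed
  qed
  show ?thesis
    unfolding Let_def using A\<^sub>1 A\<^sub>2(1) main[OF _ _ refl] by blast
qed

end

text \<open>This inserts the third summand \<open>w\<close> of the bracket and passes to constants
  common to both inequalities.\<close>

lemma weaken_bound:
  fixes a b A B u v w m x :: real
  assumes "x \<le> a * (u + v) * exp (- b * m)" "0 < a" "a \<le> A" "B \<le> b" "u \<ge> 0" "v \<ge> 0" "w \<ge> 0" "m \<ge> 0"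
  shows "x \<le> A * (u + v + w) * exp (- B * m)"
proof -
  have "a * (u + v) * exp (- b * m) \<le> A * (u + v + w) * exp (- B * m)"
    using assms by (intro mult_mono) (auto simp: mult_right_mono)
  with assms(1) show ?thesis by linarith
qed

section \<open>Both inequalities with common constants\<close>

theorem theorem3p2:
  fixes M :: "'w measure"
    and X :: "nat ^ 'n::finite \<Rightarrow> 'w \<Rightarrow> 's::banach"
    and Y :: "nat ^ 'n \<Rightarrow> 'w \<Rightarrow> 'h::{real_inner, complete_space, second_countable_topology}"
    and e :: "nat \<Rightarrow> 'h"
    and p :: "('s \<Rightarrow> real) \<Rightarrow> ennreal"
    and g :: "'s \<Rightarrow> real"
    and d\<^sub>0 d\<^sub>1 \<kappa>\<^sub>0 \<kappa>\<^sub>1 \<gamma> :: real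
  assumes "prob_space M"
    and "orthonormal_basis e"
    and "stationary_field M (borel \<Otimes>\<^sub>M borel) (\<lambda>s \<omega>. (X s \<omega>, Y s \<omega>))"
    and "d\<^sub>0 > 0" "d\<^sub>1 > 0" "\<kappa>\<^sub>0 > 0" "\<kappa>\<^sub>1 > 0" "\<gamma> > 0"
    and "\<And>s j. s \<in> pos_index \<Longrightarrow> j \<ge> 1 \<Longrightarrow>
           integrable M (\<lambda>\<omega>. (inner (Y s \<omega>) (e j))\<^sup>2) \<and>
           (LINT \<omega>|M. (inner (Y s \<omega>) (e j))\<^sup>2) \<le> d\<^sub>0 * exp (- d\<^sub>1 * real j)"
    and "\<And>s z. s \<in> pos_index \<Longrightarrow> z \<ge> 0 \<Longrightarrow>
           measure M {\<omega> \<in> space M. norm (Y s \<omega>) \<ge> z} \<le> \<kappa>\<^sub>0 * exp (- \<kappa>\<^sub>1 * z powr \<gamma>)"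
    and "pseudo_norm p"
    and "(SUP j\<in>{1..}. SUP B\<in>{0<..}.
            \<Sum>i. phi_coeff M p X (truncated_coord e Y j B) (Suc i)) < \<infinity>"
    and "g \<in> unit_class p"
    and "p g > 0"
  shows "\<exists>A\<^sub>1>0. \<exists>A\<^sub>2>0. \<forall>n\<in>pos_index. \<forall>\<epsilon>>0.
    (let S = field_sum X Y g n;
         I = real (card (rect n));
         T = I powr (1 / real CARD('n)) * inverse (enn2real (p g));
         m = (\<epsilon>\<^sup>2 * T) powr (\<gamma> / (2 + 2 * \<gamma>));
         P = measure M {\<omega> \<in> space M. inverse I * norm (S \<omega> - integral\<^sup>L M S) \<ge> \<epsilon>}
     in P \<le> A\<^sub>1 * (\<epsilon> powr (- 2) + m
                   + m powr ((4 + 5 * \<gamma>) / (4 + 2 * \<gamma>)) * \<epsilon> powr (- 3 * \<gamma> / (2 + \<gamma>))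
                       * T powr ((1 - \<gamma>) / (2 + \<gamma>)))
               * exp (- A\<^sub>2 * (\<epsilon>\<^sup>2 * T) powr (\<gamma> / (2 + 2 * \<gamma>)))
        \<and> (\<gamma> \<ge> 1 \<longrightarrow>
            P \<le> A\<^sub>1 * (\<epsilon> powr (- 2) + (\<epsilon>\<^sup>2 * T) powr (1 / 4)
                   + (\<epsilon>\<^sup>2 * T) powr (9 / 24) * \<epsilon> powr (- 1))
               * exp (- A\<^sub>2 * (\<epsilon>\<^sup>2 * T) powr (1 / 4))))"
proof -
  interpret prob_space M by fact
  define \<Sigma> where "\<Sigma> = (SUP j\<in>{1..}. SUP B\<in>{0<..}.
            \<Sum>i. phi_coeff M p X (truncated_coord e Y j B) (Suc i))"
  \<comment> \<open>Finiteness of the supremum matters, since \<open>enn2real\<close> would turn an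
    infinite value into 0.\<close>
  have \<Sigma>: "ennreal (enn2real \<Sigma>) = \<Sigma>" using assms(12) by (simp add: \<Sigma>_def)
  have "bounded (range g)" using assms(13) by (simp add: unit_class_def bounded_funs_def)
  then obtain G where G: "G > 0" "\<And>x. \<bar>g x\<bar> \<le> G" by (auto simp: bounded_pos)
  have pair: "(\<lambda>\<omega>. (X s \<omega>, Y s \<omega>)) \<in> measurable M (borel \<Otimes>\<^sub>M borel)" if "s \<in> pos_index" for s
    using assms(3) that by (simp add: stationary_field_def)
  interpret mixing_hilbert_field M X Y e p g d\<^sub>0 d\<^sub>1 G "enn2real \<Sigma>"
  proof
    show "X s \<in> borel_measurable M" "Y s \<in> borel_measurable M" if "s \<in> pos_index" for s
      using measurable_compose[OF pair[OF that] measurable_fst]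
        measurable_compose[OF pair[OF that] measurable_snd] by simp_all
    show "(\<Sum>i. phi_coeff M p X (truncated_coord e Y j B) (Suc i)) \<le> ennreal (enn2real \<Sigma>)"
      if "j \<ge> 1" "B > 0" for j :: nat and B :: real
      unfolding \<Sigma> unfolding \<Sigma>_def using that by (intro SUP_upper2[of j] SUP_upper2[of B]) auto
  qed (use assms G in auto)
  define q where "q = enn2real (p g)"
  have "p g \<le> 1" using assms(13) by (simp add: unit_class_def)
  then have q: "0 < q" "q \<le> 1"
    using assms(14) by (auto simp: q_def enn2real_positive_iff enn2real_leI le_less_trans)
  define bound where "bound \<gamma> A\<^sub>1 A\<^sub>2 \<longleftrightarrow> (\<forall>n\<in>pos_index. \<forall>\<epsilon>>0.
    (let S = field_sum X Y g n;
         I = real (card (rect n));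
         m = (\<epsilon>\<^sup>2 * (I powr (1 / real CARD('n)) * inverse q)) powr (\<gamma> / (2 + 2 * \<gamma>))
     in prob {\<omega> \<in> space M. inverse I * norm (S \<omega> - expectation S) \<ge> \<epsilon>}
       \<le> A\<^sub>1 * (\<epsilon> powr (- 2) + m) * exp (- A\<^sub>2 * m)))" for \<gamma> A\<^sub>1 A\<^sub>2
  obtain a b where ab: "a > 0" "b > 0" "bound \<gamma> a b"
    using exponential_bound[OF assms(10) assms(6-8) q] unfolding bound_def by blast
  \<comment> \<open>The bound is derived a second time with tail exponent 1. For
    \<open>\<gamma> < 1\<close> the implication is vacuous and any positive constants serve.\<close>
  have "\<exists>a>0. \<exists>b>0. \<gamma> \<ge> 1 \<longrightarrow> bound 1 a b"
  proof (cases "\<gamma> \<ge> 1")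
    case True
    have "prob {\<omega> \<in> space M. norm (Y s \<omega>) \<ge> z} \<le> (\<kappa>\<^sub>0 * exp \<kappa>\<^sub>1) * exp (- \<kappa>\<^sub>1 * z powr 1)"
      if "s \<in> pos_index" "z \<ge> 0" for s z
    proof -
      \<comment> \<open>Lowering the exponent to 1 fails only for \<open>z < 1\<close>; the added 1
        covers this range and costs the factor \<open>exp \<kappa>\<^sub>1\<close>.\<close>
      have "z \<le> 1 + z powr \<gamma>"
      proof (cases "z \<le> 1")
        case False
        then have "z powr 1 \<le> z powr \<gamma>" using True by (intro powr_mono) auto
        then show ?thesis using False by simp
      qed (simp add: add_increasing2)
      then have "- \<kappa>\<^sub>1 * z powr \<gamma> \<le> \<kappa>\<^sub>1 + - \<kappa>\<^sub>1 * z powr 1"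
        using that mult_left_mono[of z "1 + z powr \<gamma>" \<kappa>\<^sub>1] assms(7) by (simp add: algebra_simps)
      then have "\<kappa>\<^sub>0 * exp (- \<kappa>\<^sub>1 * z powr \<gamma>) \<le> \<kappa>\<^sub>0 * exp (\<kappa>\<^sub>1 + - \<kappa>\<^sub>1 * z powr 1)"
        using assms(6) by (intro mult_left_mono) auto
      also have "\<dots> = \<kappa>\<^sub>0 * exp \<kappa>\<^sub>1 * exp (- \<kappa>\<^sub>1 * z powr 1)"
        unfolding exp_add by (rule mult.assoc[symmetric])
      finally show ?thesis by (rule order_trans[OF assms(10)[OF that]])
    qed
    from exponential_bound[OF this _ assms(7) _ q] show ?thesis
      using assms(6) unfolding bound_def by auto
  qed (use ab in blast)
  then obtain a' b' where ab': "a' > 0" "b' > 0" "\<gamma> \<ge> 1 \<longrightarrow> bound 1 a' b'" by blast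
  show ?thesis
    unfolding Let_def q_def[symmetric]
  proof (rule exI[of _ "max a a'"], rule conjI, use ab in simp, rule exI[of _ "min b b'"],
      rule conjI, use ab ab' in simp, intro ballI allI impI conjI)
    fix n :: "nat ^ 'n" and \<epsilon> :: real
    assume n: "n \<in> pos_index" and \<epsilon>: "\<epsilon> > 0"
    let ?P = "prob {\<omega> \<in> space M. inverse (real (card (rect n))) *
      norm (field_sum X Y g n \<omega> - expectation (field_sum X Y g n)) \<ge> \<epsilon>}"
    let ?T = "real (card (rect n)) powr (1 / real CARD('n)) * inverse q"
    let ?m = "(\<epsilon>\<^sup>2 * ?T) powr (\<gamma> / (2 + 2 * \<gamma>))"
    have "?P \<le> a * (\<epsilon> powr (- 2) + ?m) * exp (- b * ?m)"
      using ab(3) n \<epsilon> unfolding bound_def Let_def by blast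
    then show "?P \<le> max a a' * (\<epsilon> powr (- 2) + ?m
        + ?m powr ((4 + 5 * \<gamma>) / (4 + 2 * \<gamma>)) * \<epsilon> powr (- 3 * \<gamma> / (2 + \<gamma>)) * ?T powr ((1 - \<gamma>) / (2 + \<gamma>)))
      * exp (- min b b' * ?m)"
      by (rule weaken_bound) (use ab in auto)
    show "?P \<le> max a a' * (\<epsilon> powr (- 2) + (\<epsilon>\<^sup>2 * ?T) powr (1 / 4)
        + (\<epsilon>\<^sup>2 * ?T) powr (9 / 24) * \<epsilon> powr (- 1))
      * exp (- min b b' * (\<epsilon>\<^sup>2 * ?T) powr (1 / 4))" if "\<gamma> \<ge> 1"
    proof (rule weaken_bound)
      have "bound 1 a' b'" using ab'(3) that by blast
      \<comment> \<open>For tail exponent 1 the power in \<open>m\<close> becomes 1 / 4.\<close>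
      then have "?P \<le> a' * (\<epsilon> powr (- 2) + (\<epsilon>\<^sup>2 * ?T) powr (1 / (2 + 2 * 1)))
          * exp (- b' * (\<epsilon>\<^sup>2 * ?T) powr (1 / (2 + 2 * 1)))"
        using n \<epsilon> unfolding bound_def Let_def by blast
      then show "?P \<le> a' * (\<epsilon> powr (- 2) + (\<epsilon>\<^sup>2 * ?T) powr (1 / 4)) * exp (- b' * (\<epsilon>\<^sup>2 * ?T) powr (1 / 4))"
        by simp
    qed (use ab' in auto)
  qed
qed

end
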